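(* Let $c>0$, $0<r<1$, and let $\Gamma_1=\Gamma_2=\Gamma_3$ be a nonzero integer. Consider the equilateral relative equilibrium of three vortices, i.e. the fixed point $\mu_0$ of the three-vortex relative dynamics given by $$\mu_1=\mu_2=\mu_3=r^2,\qquad \overline{\mu_{12}}=\overline{\mu_{23}}=\mu_{13}=r^2e^{2\pi\mathrm i/3}.$$ If $$F_2(c,r)=2r^4-c(1-r^2)^2<0,$$ then $\mu_0$ is Lyapunov stable.
   Context: Let $N=3$ and $D_\Gamma=\operatorname{diag}(\Gamma_1,\Gamma_2,\Gamma_3)$. $\mathfrak u(N)$ denotes the real vector space of $N\times N$ complex skew-Hermitian matrices, with inner product $\langle\xi,\eta\rangle=\frac12\operatorname{tr}(\xi^*\eta)$. For smooth $f$ on an open subset of $\mathfrak u(N)$, $\frac{\delta f}{\delta\mu}\in\mathfrak u(N)$ is defined by $\langle\nu,\frac{\delta f}{\delta\mu}\rangle=\frac{d}{ds}\big|_{s=0}f(\mu+s\nu)$ for all $\nu\in\mathfrak u(N)$. Write $\mu=\mathrm iM$ with $M$ Hermitian, with diagonal entries $\mu_i\in\mathbb R$ and above-diagonal entries $\mu_{ij}\in\mathbb C$ ($i<j$); vortices at $z_1,\dots,z_N$ in the open unit disc of $\mathbb C$ correspond to $\mu=\mathrm izz^*$, i.e. $\mu_i=|z_i|^2$ and $\mu_{ij}=z_i\overline{z_j}$. The relative dynamics is the Lie–Poisson equation $$\dot\mu=D_\Gamma^{-1}\frac{\delta h}{\delta\mu}\mu-\mu\frac{\delta h}{\delta\mu}D_\Gamma^{-1},$$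 $$h(\mu)=\frac12\Bigl(\sum_i\Gamma_i^2\ln(1-\mu_i)-c\sum_{i<j}\Gamma_i\Gamma_j\ln(\mu_i+\mu_j-2\operatorname{Re}\mu_{ij})\Bigr),$$ on the open set where $\mu_i<1$ for all $i$ and $\mu_i+\mu_j-2\operatorname{Re}\mu_{ij}>0$ for all $i<j$. The relative dynamics takes place in the invariant set $\{\mu\in\mathfrak u(N):\operatorname{rank}\mu=1\}$. A relative equilibrium (a rigidly rotating configuration) corresponds to a fixed point, and its Lyapunov stability means Lyapunov stability of this fixed point for the relative dynamics (for initial conditions in this invariant set). *)

theory Defs
  imports "HOL-Analysis.Analysis"
begin

section \<open>Skew-Hermitian matrices\<close>

definition ctranspose :: "complex^'n^'m \<Rightarrow> complex^'m^'n" where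
  "ctranspose A = (\<chi> i j. cnj (A $ j $ i))"

definition skew_hermitian :: "(complex^'n^'n) set" where
  "skew_hermitian = {\<xi>. ctranspose \<xi> = - \<xi>}"

text \<open>The trace below is real when both arguments are skew-Hermitian, so taking the
  real part only adjusts the type.\<close>

definition skew_inner :: "complex^'n^'n \<Rightarrow> complex^'n^'n \<Rightarrow> real" where
  "skew_inner \<xi> \<eta> = Re (trace (ctranspose \<xi> ** \<eta>)) / 2"

text \<open>The functional derivative; the inner product is nondegenerate on the skew-Hermitian
  matrices, so there is at most one such element, and there is one whenever the restriction
  of \<open>f\<close> to the skew-Hermitian matrices is differentiable at \<open>\<mu>\<close>.\<close>

definition func_deriv :: "(complex^'n^'n \<Rightarrow> real) \<Rightarrow> complex^'n^'n \<Rightarrow> complex^'n^'n" where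
  "func_deriv f \<mu> = (THE g. g \<in> skew_hermitian \<and>
     (\<forall>\<nu>\<in>skew_hermitian.
        ((\<lambda>s::real. f (\<mu> + s *\<^sub>R \<nu>)) has_real_derivative skew_inner \<nu> g) (at 0)))"


section \<open>Relative dynamics of three vortices\<close>

text \<open>The Hermitian matrix \<open>M\<close> with \<open>\<mu> = \<i> M\<close>, and its diagonal and off-diagonal entries.\<close>

definition herm :: "complex^3^3 \<Rightarrow> complex^3^3" where
  "herm \<mu> = (\<chi> i j. - \<i> * \<mu> $ i $ j)"

definition mu_diag :: "complex^3^3 \<Rightarrow> 3 \<Rightarrow> real" where
  "mu_diag \<mu> i = Re (herm \<mu> $ i $ i)"

definition mu_off :: "complex^3^3 \<Rightarrow> 3 \<Rightarrow> 3 \<Rightarrow> complex" where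
  "mu_off \<mu> i j = herm \<mu> $ i $ j"

text \<open>The index pairs \<open>i < j\<close> are listed explicitly: in the numeral type \<open>3\<close> the
  element \<open>3\<close> equals \<open>0\<close> and is the least one, so its built-in order is not the
  intended one.\<close>

definition index_pairs :: "(3 \<times> 3) set" where
  "index_pairs = {(1, 2), (1, 3), (2, 3)}"

text \<open>For \<open>\<mu> = \<i> z z\<^sup>*\<close> this is the squared distance of the vortices \<open>z\<^sub>i\<close> and \<open>z\<^sub>j\<close>.\<close>

definition sqdist :: "complex^3^3 \<Rightarrow> 3 \<Rightarrow> 3 \<Rightarrow> real" where
  "sqdist \<mu> i j = mu_diag \<mu> i + mu_diag \<mu> j - 2 * Re (mu_off \<mu> i j)"

definition vortex_domain :: "(complex^3^3) set" where
  "vortex_domain = {\<mu> \<in> skew_hermitian. (\<forall>i. mu_diag \<mu> i < 1) \<and>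
     (\<forall>(i, j)\<in>index_pairs. sqdist \<mu> i j > 0)}"

definition vortex_ham :: "real \<Rightarrow> real^3 \<Rightarrow> complex^3^3 \<Rightarrow> real" where
  "vortex_ham c \<Gamma> \<mu> = 1 / 2 *
     ((\<Sum>i\<in>UNIV. (\<Gamma> $ i)\<^sup>2 * ln (1 - mu_diag \<mu> i))
      - c * (\<Sum>(i, j)\<in>index_pairs. \<Gamma> $ i * \<Gamma> $ j * ln (sqdist \<mu> i j)))"

definition circ_matrix :: "real^3 \<Rightarrow> complex^3^3" where
  "circ_matrix \<Gamma> = (\<chi> i j. if i = j then complex_of_real (\<Gamma> $ i) else 0)"

definition relative_field :: "real \<Rightarrow> real^3 \<Rightarrow> complex^3^3 \<Rightarrow> complex^3^3" where
  "relative_field c \<Gamma> \<mu> =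
     matrix_inv (circ_matrix \<Gamma>) ** func_deriv (vortex_ham c \<Gamma>) \<mu> ** \<mu>
     - \<mu> ** func_deriv (vortex_ham c \<Gamma>) \<mu> ** matrix_inv (circ_matrix \<Gamma>)"

definition rank_one :: "(complex^3^3) set" where
  "rank_one = {\<mu> \<in> skew_hermitian. rank \<mu> = 1}"


section \<open>Lyapunov stability\<close>

definition solution_on ::
  "('a::real_normed_vector \<Rightarrow> 'a) \<Rightarrow> 'a set \<Rightarrow> real set \<Rightarrow> (real \<Rightarrow> 'a) \<Rightarrow> bool" where
  "solution_on F U J x \<longleftrightarrow>
     (\<forall>t\<in>J. x t \<in> U \<and> (x has_vector_derivative F (x t)) (at t within J))"

text \<open>Lyapunov stability of the fixed point \<open>p\<close> of \<open>x' = F x\<close> on the phase space \<open>U\<close>, for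
  initial conditions in the set \<open>S\<close>. Since the flow on \<open>U\<close> may be incomplete, the definition
  asks both that nearby initial conditions have a solution for all \<open>t \<ge> 0\<close> and that every
  solution starting there stays close to \<open>p\<close> for as long as it is defined.\<close>

definition lyapunov_stable ::
  "('a::real_normed_vector \<Rightarrow> 'a) \<Rightarrow> 'a set \<Rightarrow> 'a set \<Rightarrow> 'a \<Rightarrow> bool" where
  "lyapunov_stable F U S p \<longleftrightarrow>
     p \<in> U \<inter> S \<and> F p = 0 \<and>
     (\<forall>\<epsilon>>0. \<exists>\<delta>>0. \<forall>m\<in>U \<inter> S. dist m p < \<delta> \<longrightarrow>
        (\<exists>x. solution_on F U {0..} x \<and> x 0 = m) \<and>
        (\<forall>T\<ge>0. \<forall>x. solution_on F U {0..T} x \<and> x 0 = m \<longrightarrow>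
           (\<forall>t\<in>{0..T}. dist (x t) p < \<epsilon>)))"

definition F2 :: "real \<Rightarrow> real \<Rightarrow> real" where
  "F2 c r = 2 * r ^ 4 - c * (1 - r\<^sup>2)\<^sup>2"

end

(*
For equal circulations the relative dynamics is mu' = [G, mu] with G = (1 / Gamma) dh/dmu
skew-Hermitian, so h, the trace, and the norm of mu (mu - tau I) for a constant tau are conserved.
With tau = 3 i r^2 the trace condition together with mu (mu - tau I) = 0 forces mu = i z z^* near the
equilibrium, with |z|^2 = 3 r^2. In the Fourier coordinates z_j = A0 + omega^j A1 + omega^(-j) A2 the
mutual distances do not involve A0, and to second order
  sum ln (1 - |z_j|^2)  = const - 3 r^2 |A0 + cnj A2|^2 / (1 - r^2)^2    (for A1 = r up to phase),
  sum ln |z_j - z_k|^2  = const - 3 (|A0|^2 + |A2|^2) / r^2.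
Since |A0 + cnj A2|^2 <= 2 (|A0|^2 + |A2|^2), the condition F2 < 0 makes h a strict local minimum, and
the three conserved quantities together isolate the equilibrium.
*)

theory Submission
  imports Defs "HOL-Real_Asymp.Real_Asymp"
begin

section \<open>Picard iteration and conserved functions\<close>

text \<open>The set \<open>rank_one\<close> is curved, so minimality of the energy on it does not by
  itself control a ball of matrices. Freezing \<tau> at the equilibrium trace, instead of taking the
  current trace, makes the quadratic residual polynomial with constant coefficients; its norm is
  conserved on all of \<open>vortex_domain\<close>, and this replaces an invariance proof for
  \<open>rank_one\<close>. Stability is obtained for every nearby initial value in
  \<open>vortex_domain\<close>.

  The vector \<open>z\<close> is determined by the matrix only up to a common phase. Closeness to
  the equilibrium is therefore measured by the squared moduli of A0 and A2, which do not see that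
  phase and are linear in the matrix, while the energy estimate is uniform in the phase of A1.

  The definition of stability also asks for solutions for all positive times. These come from a
  globally Lipschitz extension of the field, and the conserved quantity then keeps its solutions in
  the region where the extension agrees with the original field.\<close>

lemma has_vector_derivative_atLeast_local:
  assumes "\<And>b. b > t \<Longrightarrow> (f has_vector_derivative d) (at t within {a..b})"
  shows "(f has_vector_derivative d) (at t within {a..})"
proof -
  have "at t within {a..} = at t within {a..t+1}"
    by (rule at_within_nhd[of t "{..<t+1}"]) auto
  then show ?thesis using assms[of "t+1"] by simp
qed

lemma indefinite_integral_has_vector_derivative_atLeast:
  fixes g :: "real \<Rightarrow> 'a::banach"
  assumes "continuous_on UNIV g" and "t \<ge> a"
  shows "((\<lambda>s. integral {a..s} g) has_vector_derivative g t) (at t within {a..})"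
  by (rule has_vector_derivative_atLeast_local, rule integral_has_vector_derivative)
    (use assms in \<open>auto intro: continuous_on_subset\<close>)

text \<open>In the norm weighted by \<open>exp (- 2 L t)\<close> the Picard operator is a contraction on the whole
  half-line at once, so that no continuation argument is needed.\<close>

lemma lipschitz_bounded_ode_global_solution:
  fixes G :: "'a::banach \<Rightarrow> 'a"
  assumes lip: "L-lipschitz_on UNIV G" and bdd: "bounded (range G)"
  obtains y where "y 0 = m"
    and "\<And>t. t \<ge> 0 \<Longrightarrow> (y has_vector_derivative G (y t)) (at t within {0..})"
proof -
  \<comment> \<open>Adding 1 keeps the constant positive when \<open>L = 0\<close>, so division by
    \<open>2 * K\<close> is legitimate.\<close>
  define K where "K = L + 1"
  have "L \<ge> 0" using lip lipschitz_on_nonneg by blast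
  then have K: "K > 0" by (simp add: K_def)
  have lipK: "norm (G u - G v) \<le> K * norm (u - v)" for u v
    using lipschitz_on_normD[OF lip, of u v] by (simp add: K_def algebra_simps add_increasing)
  obtain B where B: "\<And>u. norm (G u) \<le> B" and B0: "B > 0"
    using bdd by (auto simp: bounded_pos)
  have contG: "continuous_on UNIV G" by (rule lipschitz_on_continuous_on[OF lip])
  \<comment> \<open>The unknown is rescaled: the trajectory is \<open>m\<close> plus
    \<open>exp (2 * K * u)\<close> times a bounded continuous function, so the sup norm of that
    function is the weighted norm of the trajectory.\<close>
  define g where "g y = (\<lambda>u. G (m + exp (2 * K * u) *\<^sub>R apply_bcontfun y u))" for y
  define J where "J y = (\<lambda>s. integral {0..s} (g y))" for y
  \<comment> \<open>Elements of the space of bounded continuous functions live on the whole real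
    line; \<open>max 0 t\<close> extends by a constant to negative times.\<close>
  define H where "H y = (\<lambda>t. exp (- (2 * K * max 0 t)) *\<^sub>R J y (max 0 t))" for y
  have contg: "continuous_on UNIV (g y)" for y
    unfolding g_def by (intro continuous_intros continuous_on_compose2[OF contG]) auto
  have dJ: "(J y has_vector_derivative g y t) (at t within {0..})" if "t \<ge> 0" for y t
    unfolding J_def
    by (rule indefinite_integral_has_vector_derivative_atLeast[OF contg that])
  have contJ: "continuous_on {0..} (J y)" for y
    using dJ has_vector_derivative_continuous by (fastforce simp: continuous_on_eq_continuous_within)
  have contH: "continuous_on UNIV (H y)" for y
    unfolding H_def by (intro continuous_intros continuous_on_compose2[OF contJ]) auto
  have intg: "g y integrable_on {0..s}" for y s
    by (rule integrable_continuous_real) (rule continuous_on_subset[OF contg], auto)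
  have bddJ: "norm (J y s) \<le> s * B" if "s \<ge> 0" for y s
  proof -
    have "norm (integral {0..s} (g y)) \<le> integral {0..s} (\<lambda>_. B)"
      by (rule integral_norm_bound_integral[OF intg]) (auto simp: g_def B)
    then show ?thesis using that by (simp add: J_def)
  qed
  \<comment> \<open>A bounded \<open>G\<close> lets the integral grow at most linearly, and the
    exponential weight absorbs this growth.\<close>
  have Hb: "norm (H y t) \<le> B / (2 * K)" for y t
  proof -
    define s where "s = max 0 t"
    have s: "s \<ge> 0" by (simp add: s_def)
    have "2 * K * s \<le> exp (2 * K * s)" using exp_ge_add_one_self[of "2 * K * s"] by linarith
    then have *: "s \<le> exp (2 * K * s) / (2 * K)" using K by (simp add: field_simps)
    have "norm (H y t) = exp (- (2 * K * s)) * norm (J y s)" by (simp add: H_def s_def)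
    also have "\<dots> \<le> exp (- (2 * K * s)) * (s * B)"
      by (intro mult_left_mono bddJ s) simp
    also have "\<dots> \<le> exp (- (2 * K * s)) * (exp (2 * K * s) / (2 * K) * B)"
      by (intro mult_left_mono mult_right_mono *) (use B0 in auto)
    also have "\<dots> = B / (2 * K)" by (simp add: exp_minus field_simps)
    finally show ?thesis .
  qed
  have Hbc: "H y \<in> bcontfun" for y
    by (rule bcontfun_normI[OF contH Hb])
  define \<Phi> where "\<Phi> y = Bcontfun (H y)" for y
  have Phi: "apply_bcontfun (\<Phi> y) = H y" for y
    unfolding \<Phi>_def by (rule Bcontfun_inverse[OF Hbc])
  \<comment> \<open>The exponent \<open>2 * K\<close> against the Lipschitz constant
    \<open>K\<close> leaves the factor 1/2, which becomes the contraction constant.\<close>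
  have expint: "((\<lambda>u. K * exp (2 * K * u) * d) has_integral (exp (2 * K * s) * d / 2 - d / 2)) {0..s}"
    if "s \<ge> 0" for s d
  proof -
    have "((\<lambda>u. K * exp (2 * K * u) * d) has_integral
        ((\<lambda>u. exp (2 * K * u) * d / 2) s - (\<lambda>u. exp (2 * K * u) * d / 2) 0)) {0..s}"
      by (rule fundamental_theorem_of_calculus[OF that])
        (auto intro!: derivative_eq_intros simp: has_real_derivative_iff_has_vector_derivative[symmetric])
    then show ?thesis by simp
  qed
  have contraction: "dist (\<Phi> y) (\<Phi> z) \<le> 1 / 2 * dist y z" for y z
  proof (rule dist_bound)
    fix t :: real
    define s where "s = max 0 t"
    define d where "d = dist y z"
    have s: "s \<ge> 0" and d: "d \<ge> 0" by (simp_all add: s_def d_def)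
    have bound: "norm (g y u - g z u) \<le> K * exp (2 * K * u) * d" for u
    proof -
      have "norm (g y u - g z u)
          \<le> K * norm (exp (2 * K * u) *\<^sub>R apply_bcontfun y u - exp (2 * K * u) *\<^sub>R apply_bcontfun z u)"
        unfolding g_def using lipK[of "m + exp (2 * K * u) *\<^sub>R apply_bcontfun y u"
            "m + exp (2 * K * u) *\<^sub>R apply_bcontfun z u"] by simp
      also have "\<dots> = K * exp (2 * K * u) * dist (apply_bcontfun y u) (apply_bcontfun z u)"
        by (simp add: scaleR_diff_right[symmetric] dist_norm)
      also have "\<dots> \<le> K * exp (2 * K * u) * d"
        unfolding d_def by (intro mult_left_mono dist_bounded) (use K in auto)
      finally show ?thesis .
    qed
    have "norm (J y s - J z s) = norm (integral {0..s} (\<lambda>u. g y u - g z u))"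
      unfolding J_def by (simp add: integral_diff[OF intg intg])
    also have "\<dots> \<le> integral {0..s} (\<lambda>u. K * exp (2 * K * u) * d)"
      by (rule integral_norm_bound_integral)
        (use bound expint[OF s] in \<open>auto intro: integrable_diff intg has_integral_integrable\<close>)
    also have "\<dots> = exp (2 * K * s) * d / 2 - d / 2"
      by (rule integral_unique[OF expint[OF s]])
    also have "\<dots> \<le> exp (2 * K * s) * d / 2" using d by simp
    finally have *: "norm (J y s - J z s) \<le> exp (2 * K * s) * d / 2" .
    have "dist (H y t) (H z t) = exp (- (2 * K * s)) * norm (J y s - J z s)"
      by (simp add: H_def s_def dist_norm scaleR_diff_right[symmetric])
    also have "\<dots> \<le> exp (- (2 * K * s)) * (exp (2 * K * s) * d / 2)"
      by (intro mult_left_mono *) simp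
    also have "\<dots> = d / 2" by (simp add: exp_minus field_simps)
    finally show "dist (apply_bcontfun (\<Phi> y) t) (apply_bcontfun (\<Phi> z) t) \<le> 1 / 2 * dist y z"
      by (simp add: Phi d_def)
  qed
  obtain x where x: "\<Phi> x = x"
    using banach_fix_type[of "1/2" \<Phi>] contraction by auto
  define y where "y t = m + J x t" for t
  have yx: "g x t = G (y t)" if "t \<ge> 0" for t
  proof -
    have "apply_bcontfun x t = H x t" using x Phi by metis
    then have "exp (2 * K * t) *\<^sub>R apply_bcontfun x t = J x t"
      using that by (simp add: H_def exp_minus)
    then show ?thesis by (simp add: g_def y_def)
  qed
  show thesis
  proof
    show "y 0 = m" by (simp add: y_def J_def)
    fix t :: real assume t: "t \<ge> 0"
    show "(y has_vector_derivative G (y t)) (at t within {0..})"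
      unfolding y_def using dJ[OF t, of x] yx[OF t]
      by (auto intro!: derivative_eq_intros simp: y_def)
  qed
qed

section \<open>Lyapunov stability from a conserved function\<close>

lemma solution_on_subset:
  assumes "solution_on F U J x" and "J' \<subseteq> J"
  shows "solution_on F U J' x"
  using assms unfolding solution_on_def
  by (meson has_vector_derivative_within_subset subsetD)

lemma solution_on_continuous:
  assumes "solution_on F U J x"
  shows "continuous_on J x"
  using assms unfolding solution_on_def continuous_on_eq_continuous_within
  by (blast intro: has_vector_derivative_continuous)

text \<open>The time \<open>s\<close> is the infimum of the closed set where \<open>f\<close> is at
  least \<open>e\<close>. The intermediate value theorem gives a time at most \<open>s\<close> with
  value exactly \<open>e\<close>, and minimality forces that time to be \<open>s\<close>.\<close>

lemma continuous_first_exit: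
  fixes f :: "real \<Rightarrow> real"
  assumes cont: "continuous_on {0..T} f" and "f 0 < e" and "e \<le> f T" and "0 \<le> T"
  obtains s where "0 \<le> s" "s \<le> T" "f s = e" "\<forall>u\<in>{0..s}. f u \<le> e"
proof -
  define A where "A = {0..T} \<inter> f -` {e..}"
  have clA: "closed A"
    unfolding A_def by (rule continuous_closed_preimage[OF cont]) auto
  have ne: "A \<noteq> {}" and bb: "bdd_below A" using assms by (auto simp: A_def)
  define s where "s = Inf A"
  have sA: "s \<in> A" unfolding s_def by (rule closed_contains_Inf[OF ne bb clA])
  have lt: "f u < e" if "0 \<le> u" "u < s" for u
  proof (rule ccontr)
    assume "\<not> f u < e"
    then have "u \<in> A" using that sA by (auto simp: A_def)
    then have "s \<le> u" unfolding s_def using bb cInf_lower by blast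
    then show False using that by simp
  qed
  have s: "0 \<le> s" "s \<le> T" "e \<le> f s" using sA by (auto simp: A_def)
  have "continuous_on {0..s} f" using cont s by (auto intro: continuous_on_subset)
  then obtain u where u: "0 \<le> u" "u \<le> s" "f u = e"
    using IVT'[of f 0 e s] assms s by auto
  then have "u = s" using lt[of u] by fastforce
  with u have "f s = e" by simp
  moreover have "f u \<le> e" if "u \<in> {0..s}" for u
    using lt[of u] that \<open>f s = e\<close> by (cases "u = s") auto
  ultimately show thesis using that s(1,2) by simp
qed

text \<open>The phase space is an open part of the linear subspace \<open>{m. P m = 0}\<close>. The values of a
  conserved function that determines \<open>p\<close> near \<open>p\<close> cannot cross the minimum of \<open>\<bar>V m - V p\<bar>\<close> over a
  small sphere.\<close>

lemma lyapunov_stable_by_conserved_function: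
  fixes F :: "'a::euclidean_space \<Rightarrow> 'a" and P :: "'a \<Rightarrow> 'b::real_normed_vector" and V :: "'a \<Rightarrow> real"
  assumes P: "bounded_linear P" and UP: "\<And>m. m \<in> U \<Longrightarrow> P m = 0"
    and p: "p \<in> U" "p \<in> S" and e0: "e0 > 0"
    and ball: "cball p e0 \<inter> {m. P m = 0} \<subseteq> U"
    and lip: "L-lipschitz_on (cball p e0 \<inter> {m. P m = 0}) F"
    and PF: "\<And>m. m \<in> U \<Longrightarrow> P (F m) = 0"
    and contV: "continuous_on U V"
    and cons: "\<And>T x. T \<ge> 0 \<Longrightarrow> solution_on F U {0..T} x \<Longrightarrow> V (x T) = V (x 0)"
    and iso: "\<And>m. m \<in> cball p e0 \<Longrightarrow> P m = 0 \<Longrightarrow> V m = V p \<Longrightarrow> m = p"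
  shows "lyapunov_stable F U S p"
proof -
  interpret P: bounded_linear P by (rule P)
  have clK: "closed {m. P m = 0}"
    by (rule closed_Collect_eq) (auto intro: linear_continuous_on P continuous_intros)
  have cvK: "convex {m. P m = 0}"
    by (auto simp: convex_def P.add P.scaleR)
  have stay: "\<exists>\<delta>>0. \<delta> \<le> e \<and> (\<forall>m\<in>U. dist m p < \<delta> \<longrightarrow>
      (\<forall>T\<ge>0. \<forall>x. solution_on F U {0..T} x \<and> x 0 = m \<longrightarrow> dist (x T) p < e))"
    if e: "0 < e" "e \<le> e0" for e
  proof -
    define Z where "Z = sphere p e \<inter> {m. P m = 0}"
    have cZ: "compact Z" unfolding Z_def by (intro compact_Int_closed clK) auto
    have ZU: "Z \<subseteq> U" using ball e by (auto simp: Z_def)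
    \<comment> \<open>A positive minimum exists by compactness and \<open>iso\<close>. An empty
      \<open>Z\<close> occurs when the subspace is trivial, and any positive number serves
      there.\<close>
    have "\<exists>\<alpha>>0. \<forall>m\<in>Z. \<alpha> \<le> \<bar>V m - V p\<bar>"
    proof (cases "Z = {}")
      case False
      have "continuous_on Z (\<lambda>m. \<bar>V m - V p\<bar>)"
        by (intro continuous_intros continuous_on_subset[OF contV ZU])
      from continuous_attains_inf[OF cZ False this] obtain m0 where
        m0: "m0 \<in> Z" "\<forall>m\<in>Z. \<bar>V m0 - V p\<bar> \<le> \<bar>V m - V p\<bar>" by blast
      have "m0 \<noteq> p" "m0 \<in> cball p e0" "P m0 = 0" using m0(1) e by (auto simp: Z_def)
      then have "V m0 \<noteq> V p" using iso by blast
      then show ?thesis using m0 by (intro exI[of _ "\<bar>V m0 - V p\<bar>"]) auto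
    qed (auto intro: exI[of _ 1])
    then obtain \<alpha> where \<alpha>: "\<alpha> > 0" "\<And>m. m \<in> Z \<Longrightarrow> \<alpha> \<le> \<bar>V m - V p\<bar>" by blast
    obtain \<delta> where \<delta>: "\<delta> > 0" "\<And>m. m \<in> U \<Longrightarrow> dist m p < \<delta> \<Longrightarrow> dist (V m) (V p) < \<alpha>"
      using contV p \<alpha>(1) unfolding continuous_on_iff by blast
    have "dist (x T) p < e"
      if m: "x 0 \<in> U" "dist (x 0) p < min \<delta> e" and T: "T \<ge> 0" and x: "solution_on F U {0..T} x"
      for x T
    proof (rule ccontr)
      assume "\<not> dist (x T) p < e"
      then have out: "e \<le> dist (x T) p" by simp
      have cont: "continuous_on {0..T} (\<lambda>t. dist (x t) p)"
        by (intro continuous_intros solution_on_continuous[OF x])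
      have start: "dist (x 0) p < e" using m(2) by simp
      obtain s where s: "0 \<le> s" "s \<le> T" "dist (x s) p = e"
        by (rule continuous_first_exit[OF cont start out T])
      have "x s \<in> U" using x s by (auto simp: solution_on_def)
      then have "x s \<in> Z" using s UP by (auto simp: Z_def dist_commute)
      moreover have "V (x s) = V (x 0)"
        by (rule cons[OF s(1) solution_on_subset[OF x]]) (use s in auto)
      ultimately show False using \<alpha>(2)[of "x s"] \<delta>(2)[of "x 0"] m by (auto simp: dist_real_def)
    qed
    then show ?thesis using \<delta>(1) e by (intro exI[of _ "min \<delta> e"]) auto
  qed
  have exist: "\<exists>\<delta>>0. \<forall>m\<in>U. dist m p < \<delta> \<longrightarrow>
      (\<exists>x. solution_on F U {0..} x \<and> x 0 = m \<and> (\<forall>t\<ge>0. dist (x t) p < e0))"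
  proof -
    obtain \<delta> where \<delta>: "\<delta> > 0" "\<delta> \<le> e0" and st: "\<And>m T x. m \<in> U \<Longrightarrow> dist m p < \<delta> \<Longrightarrow> T \<ge> 0 \<Longrightarrow>
        solution_on F U {0..T} x \<Longrightarrow> x 0 = m \<Longrightarrow> dist (x T) p < e0"
      using stay[OF e0 order_refl] by blast
    define K where "K = cball p e0 \<inter> {m. P m = 0}"
    have cK: "compact K" "closed K" "convex K" "K \<noteq> {}" and KU: "K \<subseteq> U"
      unfolding K_def using clK cvK e0 p UP ball
      by (auto intro!: compact_Int_closed closed_Int convex_Int simp: disjoint_iff intro: exI[of _ p])
    \<comment> \<open>Projection to the nearest point of the compact convex set \<open>K\<close> is
      1-Lipschitz, so the composition is a bounded, globally Lipschitz field that agrees with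
      \<open>F\<close> on \<open>K\<close>.\<close>
    define G where "G = F \<circ> closest_point K"
    have cpK: "closest_point K u \<in> K" for u by (rule closest_point_in_set[OF cK(2,4)])
    have lipG: "(L * 1)-lipschitz_on UNIV G"
      unfolding G_def
    proof (rule lipschitz_on_compose)
      show "1-lipschitz_on UNIV (closest_point K)"
        by (rule lipschitz_onI) (use closest_point_lipschitz[OF cK(3,2,4)] in auto)
      show "L-lipschitz_on (range (closest_point K)) F"
        by (rule lipschitz_on_subset[OF lip]) (use cpK in \<open>auto simp: K_def\<close>)
    qed
    have "bounded (F ` K)"
      by (rule compact_imp_bounded[OF compact_continuous_image[OF _ cK(1)]])
        (use lip lipschitz_on_continuous_on in \<open>auto simp: K_def\<close>)
    then have bG: "bounded (range G)"
      by (rule bounded_subset) (use cpK in \<open>auto simp: G_def\<close>)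
    have "\<exists>x. solution_on F U {0..} x \<and> x 0 = m \<and> (\<forall>t\<ge>0. dist (x t) p < e0)"
      if m: "m \<in> U" "dist m p < \<delta>" for m
    proof -
      obtain y where y0: "y 0 = m"
        and y: "\<And>t. t \<ge> 0 \<Longrightarrow> (y has_vector_derivative G (y t)) (at t within {0..})"
        using lipschitz_bounded_ode_global_solution[OF lipG bG] by blast
      \<comment> \<open>The modified field only takes values of \<open>F\<close> on
        \<open>K\<close>, which \<open>P\<close> annihilates. Hence \<open>y\<close> never leaves
        the subspace, and only leaving the ball could separate it from \<open>K\<close>.\<close>
      have dP: "((\<lambda>t. P (y t)) has_vector_derivative 0) (at t within {0..})" if "t \<in> {0..}" for t
      proof -
        have "P (G (y t)) = 0" using PF cpK KU by (auto simp: G_def)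
        then show ?thesis using P.has_vector_derivative[OF y[of t]] that by simp
      qed
      obtain k where k: "\<And>t. t \<in> {0..} \<Longrightarrow> P (y t) = k"
        using has_vector_derivative_zero_constant[OF convex_real_interval(1) dP] by blast
      then have Py: "P (y t) = 0" if "t \<ge> 0" for t
        using that y0 UP[OF m(1)] k[of 0] by auto
      have conty: "continuous_on {0..} y"
        using y has_vector_derivative_continuous by (fastforce simp: continuous_on_eq_continuous_within)
      have sol: "solution_on F U {0..s} y"
        if "\<forall>u\<in>{0..s}. dist (y u) p \<le> e0" for s
        unfolding solution_on_def
      proof
        fix t assume t: "t \<in> {0..s}"
        then have "y t \<in> K" using that Py[of t] by (auto simp: K_def dist_commute)
        moreover from this have "G (y t) = F (y t)" by (simp add: G_def closest_point_self)
        moreover have "(y has_vector_derivative G (y t)) (at t within {0..s})"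
          by (rule has_vector_derivative_within_subset[OF y]) (use t in auto)
        ultimately show "y t \<in> U \<and> (y has_vector_derivative F (y t)) (at t within {0..s})"
          using KU by auto
      qed
      \<comment> \<open>Up to the first time at distance \<open>e0\<close> the curve solves the
        original equation, so \<open>stay\<close> applies at that very time and contradicts
        it.\<close>
      have near: "dist (y T) p < e0" if T: "T \<ge> 0" for T
      proof (rule ccontr)
        assume "\<not> dist (y T) p < e0"
        then have out: "e0 \<le> dist (y T) p" by simp
        have cont: "continuous_on {0..T} (\<lambda>t. dist (y t) p)"
          by (intro continuous_intros continuous_on_subset[OF conty]) auto
        have start: "dist (y 0) p < e0" using m y0 \<delta>(2) by simp
        obtain s where s: "0 \<le> s" "s \<le> T" "dist (y s) p = e0" "\<forall>u\<in>{0..s}. dist (y u) p \<le> e0"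
          by (rule continuous_first_exit[OF cont start out T])
        then show False using st[OF m s(1) sol y0] s(3) by simp
      qed
      have "solution_on F U {0..} y"
        unfolding solution_on_def
      proof
        fix t :: real assume t: "t \<in> {0..}"
        have *: "solution_on F U {0..b} y" if "b > t" for b
          by (rule sol) (use near in \<open>auto intro: less_imp_le\<close>)
        have "y t \<in> U" using *[of "t+1"] t by (auto simp: solution_on_def)
        moreover have "(y has_vector_derivative F (y t)) (at t within {0..})"
          by (rule has_vector_derivative_atLeast_local) (use * t in \<open>auto simp: solution_on_def\<close>)
        ultimately show "y t \<in> U \<and> (y has_vector_derivative F (y t)) (at t within {0..})" ..
      qed
      then show ?thesis using y0 near by blast
    qed
    then show ?thesis using \<delta>(1) by blast
  qed
  \<comment> \<open>The fixed point property is a consequence of isolation: the solution from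
    \<open>p\<close> keeps the value \<open>V p\<close> inside the ball, so it is constant and its
    initial velocity \<open>F p\<close> vanishes.\<close>
  have "F p = 0"
  proof -
    obtain x where x: "solution_on F U {0..} x" "x 0 = p" "\<And>t. t \<ge> 0 \<Longrightarrow> dist (x t) p < e0"
      using exist p by force
    have xp: "x t = p" if "t \<ge> 0" for t
    proof (rule iso)
      show "x t \<in> cball p e0" using x(3)[OF that] by (simp add: dist_commute)
      show "P (x t) = 0" using UP x(1) that by (auto simp: solution_on_def)
      have "solution_on F U {0..t} x" by (rule solution_on_subset[OF x(1)]) auto
      then show "V (x t) = V p" using cons[OF that] x(2) by metis
    qed
    have "(x has_vector_derivative F p) (at 0 within {0..1})"
      using solution_on_subset[OF x(1), of "{0..1}"] x(2) by (auto simp: solution_on_def)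
    moreover have "(x has_vector_derivative 0) (at 0 within {0..1})"
      by (rule has_vector_derivative_transform[of _ _ _ "\<lambda>_. p"]) (auto simp: xp)
    ultimately show ?thesis
      using vector_derivative_unique_within_closed_interval[of 0 1 0 x] by auto
  qed
  moreover have "\<exists>\<delta>>0. \<forall>m\<in>U \<inter> S. dist m p < \<delta> \<longrightarrow>
      (\<exists>x. solution_on F U {0..} x \<and> x 0 = m) \<and>
      (\<forall>T\<ge>0. \<forall>x. solution_on F U {0..T} x \<and> x 0 = m \<longrightarrow> (\<forall>t\<in>{0..T}. dist (x t) p < \<epsilon>))"
    if \<epsilon>: "\<epsilon> > 0" for \<epsilon>
  proof -
    obtain \<delta>1 where \<delta>1: "\<delta>1 > 0" "\<forall>m\<in>U. dist m p < \<delta>1 \<longrightarrow>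
        (\<exists>x. solution_on F U {0..} x \<and> x 0 = m \<and> (\<forall>t\<ge>0. dist (x t) p < e0))"
      using exist by blast
    obtain \<delta>2 where \<delta>2: "\<delta>2 > 0" "\<forall>m\<in>U. dist m p < \<delta>2 \<longrightarrow>
      (\<forall>T\<ge>0. \<forall>x. solution_on F U {0..T} x \<and> x 0 = m \<longrightarrow> dist (x T) p < min \<epsilon> e0)"
      using stay[of "min \<epsilon> e0"] \<epsilon> e0 by auto
    have "dist (x t) p < \<epsilon>" if "x 0 \<in> U" "dist (x 0) p < \<delta>2" "t \<in> {0..T}" "solution_on F U {0..T} x" for x t T
    proof -
      have "solution_on F U {0..t} x" by (rule solution_on_subset[OF that(4)]) (use that in auto)
      then show ?thesis using \<delta>2(2) that by auto
    qed
    then show ?thesis using \<delta>1 \<delta>2(1) by (intro exI[of _ "min \<delta>1 \<delta>2"]) fastforce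
  qed
  ultimately show ?thesis using p by (simp add: lyapunov_stable_def)
qed

section \<open>The equilateral configuration minimises the energy\<close>

text \<open>The remainder is a prescribed small multiple of the square, not a cubic bound, so that
  it can be absorbed directly into a definite quadratic form.\<close>

lemma ln_one_plus_second_order:
  assumes "\<eta> > 0"
  obtains \<theta> :: real where "0 < \<theta>" "\<theta> < 1"
    and "\<And>x. \<bar>x\<bar> < \<theta> \<Longrightarrow> \<bar>ln (1 + x) - (x - x\<^sup>2 / 2)\<bar> \<le> \<eta> * x\<^sup>2"
proof -
  have "((\<lambda>x::real. (ln (1 + x) - (x - x\<^sup>2 / 2)) / x\<^sup>2) \<longlongrightarrow> 0) (at 0)"
    by real_asymp
  then have "eventually (\<lambda>x::real. dist ((ln (1 + x) - (x - x\<^sup>2 / 2)) / x\<^sup>2) 0 < \<eta>) (at 0)"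
    using assms tendstoD by blast
  then obtain d where d: "d > 0"
    "\<And>x::real. x \<noteq> 0 \<Longrightarrow> dist x 0 < d \<Longrightarrow> dist ((ln (1 + x) - (x - x\<^sup>2 / 2)) / x\<^sup>2) 0 < \<eta>"
    unfolding eventually_at by blast
  \<comment> \<open>The cap 1/2 gives \<theta> below 1, which keeps \<open>1 + x\<close>
    positive.\<close>
  have "\<bar>ln (1 + x) - (x - x\<^sup>2 / 2)\<bar> \<le> \<eta> * x\<^sup>2" if "\<bar>x\<bar> < min d (1/2)" for x :: real
  proof (cases "x = 0")
    case False
    then have "\<bar>ln (1 + x) - (x - x\<^sup>2 / 2)\<bar> / x\<^sup>2 < \<eta>"
      using d(2)[of x] that by (simp add: dist_real_def)
    then show ?thesis using False by (simp add: divide_simps)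
  qed simp
  then show thesis using that[of "min d (1/2)"] d(1) by auto
qed

section \<open>Discrete Fourier coordinates of three points\<close>

definition cube_root_unity :: complex where
  "cube_root_unity = exp (2 * complex_of_real pi * \<i> / 3)"

lemma cube_root_unity_eq: "cube_root_unity = Complex (- 1 / 2) (sqrt 3 / 2)"
proof -
  have "cube_root_unity = cis (2 * pi / 3)"
    by (simp add: cube_root_unity_def cis_conv_exp algebra_simps)
  then show ?thesis
    using cos_120 sin_120 by (simp add: complex_eq_iff mult.commute)
qed

text \<open>Hides the square root behind letters with polynomial relations, so that the identities
  below become ideal membership problems for \<open>algebra\<close>.\<close>

lemma cube_root_unity_parts:
  obtains h t where "cube_root_unity = Complex (- h) t" "2 * h = 1" "4 * t * t = 3"
proof
  show "cube_root_unity = Complex (- (1/2)) (sqrt 3 / 2)" by (simp add: cube_root_unity_eq)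
qed auto

text \<open>A cross term of modes a and b rotates like \<omega> to the power a - b from one vertex
  to the next. The three products in \<open>w\<close> all have a - b congruent to -1 modulo 3, so
  they rotate together.\<close>

lemma fourier_config_modulus:
  fixes A0 A1 A2 :: complex
  defines "\<omega> \<equiv> cube_root_unity" and "w \<equiv> A0 * cnj A1 + cnj A0 * A2 + A1 * cnj A2"
    and "S \<equiv> (cmod A0)\<^sup>2 + (cmod A1)\<^sup>2 + (cmod A2)\<^sup>2"
  shows "(cmod (A0 + A1 + A2))\<^sup>2 = S + 2 * Re w"
    and "(cmod (A0 + \<omega> * A1 + cnj \<omega> * A2))\<^sup>2 = S + 2 * Re (cnj \<omega> * w)"
    and "(cmod (A0 + cnj \<omega> * A1 + \<omega> * A2))\<^sup>2 = S + 2 * Re (\<omega> * w)"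
proof -
  obtain h t where ht: "cube_root_unity = Complex (- h) t" "2 * h = 1" "4 * t * t = 3"
    by (rule cube_root_unity_parts)
  show "(cmod (A0 + A1 + A2))\<^sup>2 = S + 2 * Re w"
    unfolding S_def w_def cmod_power2 by (simp add: algebra_simps power2_eq_square)
  show "(cmod (A0 + \<omega> * A1 + cnj \<omega> * A2))\<^sup>2 = S + 2 * Re (cnj \<omega> * w)"
    unfolding S_def w_def cmod_power2 \<omega>_def ht(1)
    using ht(2,3) by (simp, algebra)
  show "(cmod (A0 + cnj \<omega> * A1 + \<omega> * A2))\<^sup>2 = S + 2 * Re (\<omega> * w)"
    unfolding S_def w_def cmod_power2 \<omega>_def ht(1)
    using ht(2,3) by (simp, algebra)
qed

text \<open>A0 cancels in differences, and 3 is the squared modulus of 1 - \<omega>. The phase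
  multiplying \<open>v\<close> for a side is the one that \<open>fourier_config_modulus\<close>
  attaches to the opposite vertex.\<close>

lemma fourier_config_distance:
  fixes A0 A1 A2 :: complex
  defines "\<omega> \<equiv> cube_root_unity" and "v \<equiv> A1 * cnj A2"
    and "S \<equiv> (cmod A1)\<^sup>2 + (cmod A2)\<^sup>2"
  shows "(cmod ((A0 + A1 + A2) - (A0 + \<omega> * A1 + cnj \<omega> * A2)))\<^sup>2 = 3 * (S - 2 * Re (\<omega> * v))"
    and "(cmod ((A0 + A1 + A2) - (A0 + cnj \<omega> * A1 + \<omega> * A2)))\<^sup>2 = 3 * (S - 2 * Re (cnj \<omega> * v))"
    and "(cmod ((A0 + \<omega> * A1 + cnj \<omega> * A2) - (A0 + cnj \<omega> * A1 + \<omega> * A2)))\<^sup>2 = 3 * (S - 2 * Re v)"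
proof -
  obtain h t where ht: "cube_root_unity = Complex (- h) t" "2 * h = 1" "4 * t * t = 3"
    by (rule cube_root_unity_parts)
  note defs = S_def v_def cmod_power2 \<omega>_def ht(1)
  show "(cmod ((A0 + A1 + A2) - (A0 + \<omega> * A1 + cnj \<omega> * A2)))\<^sup>2 = 3 * (S - 2 * Re (\<omega> * v))"
    unfolding defs using ht(2,3) by (simp, algebra)
  show "(cmod ((A0 + A1 + A2) - (A0 + cnj \<omega> * A1 + \<omega> * A2)))\<^sup>2 = 3 * (S - 2 * Re (cnj \<omega> * v))"
    unfolding defs using ht(2,3) by (simp, algebra)
  show "(cmod ((A0 + \<omega> * A1 + cnj \<omega> * A2) - (A0 + cnj \<omega> * A1 + \<omega> * A2)))\<^sup>2 = 3 * (S - 2 * Re v)"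
    unfolding defs using ht(2,3) by (simp, algebra)
qed

text \<open>The cube roots of unity sum to zero, which kills the linear terms. For the squares,
  twice the square of Re (u w) is the squared modulus of w plus the real part of the square of u w,
  and the squares of the roots again sum to zero.\<close>

lemma cube_root_unity_Re_sums:
  fixes w :: complex
  defines "\<omega> \<equiv> cube_root_unity"
  shows "Re w + Re (\<omega> * w) + Re (cnj \<omega> * w) = 0"
    and "(Re w)\<^sup>2 + (Re (\<omega> * w))\<^sup>2 + (Re (cnj \<omega> * w))\<^sup>2 = 3 / 2 * (cmod w)\<^sup>2"
proof -
  obtain h t where ht: "cube_root_unity = Complex (- h) t" "2 * h = 1" "4 * t * t = 3"
    by (rule cube_root_unity_parts)
  note defs = cmod_power2 \<omega>_def ht(1)
  show "Re w + Re (\<omega> * w) + Re (cnj \<omega> * w) = 0"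
    using ht(2) by (simp add: defs flip: distrib_right)
  have "4 * ((Re w)\<^sup>2 + (Re (\<omega> * w))\<^sup>2 + (Re (cnj \<omega> * w))\<^sup>2) = 6 * (cmod w)\<^sup>2"
    unfolding defs using ht(2,3) by (simp, algebra)
  then show "(Re w)\<^sup>2 + (Re (\<omega> * w))\<^sup>2 + (Re (cnj \<omega> * w))\<^sup>2 = 3 / 2 * (cmod w)\<^sup>2"
    by simp
qed


lemma norm_cube_root_unity: "cmod cube_root_unity = 1"
  by (simp add: cube_root_unity_def norm_exp_eq_Re)

section \<open>Quadratic lower bound for the energy\<close>

lemma eventually_less_at_zero:
  fixes f :: "real \<Rightarrow> real"
  assumes "isCont f 0" and "f 0 < b"
  shows "eventually (\<lambda>x. f x < b) (nhds 0)"
  using assms order_tendstoD(2)[of f "f 0" "nhds 0" b]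
  by (simp add: isCont_def tendsto_at_iff_tendsto_nhds)

lemma ln_affine_triple_sum:
  fixes x y z \<eta> \<theta> :: real
  assumes ln: "\<And>x. \<bar>x\<bar> < \<theta> \<Longrightarrow> \<bar>ln (1 + x) - (x - x\<^sup>2 / 2)\<bar> \<le> \<eta> * x\<^sup>2"
    and "\<theta> < 1" and x: "\<bar>x\<bar> < \<theta>" "\<bar>y\<bar> < \<theta>" "\<bar>z\<bar> < \<theta>" and "k > 0"
    and xyz: "x + y + z = s1" "x\<^sup>2 + y\<^sup>2 + z\<^sup>2 = s2"
  shows "\<bar>ln (k * (1 + x)) + ln (k * (1 + y)) + ln (k * (1 + z)) - 3 * ln k - (s1 - s2 / 2)\<bar> \<le> \<eta> * s2"
proof -
  have "ln (k * (1 + u)) = ln k + ln (1 + u)" if "\<bar>u\<bar> < \<theta>" for u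
    using that assms(2,6) by (subst ln_mult_pos) auto
  then have "ln (k * (1 + x)) + ln (k * (1 + y)) + ln (k * (1 + z)) - 3 * ln k
      = ln (1 + x) + ln (1 + y) + ln (1 + z)" using x by simp
  moreover have "\<eta> * s2 = \<eta> * x\<^sup>2 + \<eta> * y\<^sup>2 + \<eta> * z\<^sup>2" by (simp add: xyz(2)[symmetric] algebra_simps)
  ultimately show ?thesis
    using ln[OF x(1)] ln[OF x(2)] ln[OF x(3)] xyz unfolding abs_le_iff by linarith
qed

text \<open>The Hamiltonian of a configuration with equal circulations, stripped of the positive
  factor of half the squared circulation.\<close>

definition config_energy :: "real \<Rightarrow> complex \<Rightarrow> complex \<Rightarrow> complex \<Rightarrow> real" where
  "config_energy c z1 z2 z3 =
     ln (1 - (cmod z1)\<^sup>2) + ln (1 - (cmod z2)\<^sup>2) + ln (1 - (cmod z3)\<^sup>2)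
     - c * (ln ((cmod (z1 - z2))\<^sup>2) + ln ((cmod (z1 - z3))\<^sup>2) + ln ((cmod (z2 - z3))\<^sup>2))"

text \<open>The fixed sum of squares eliminates the modulus of A1 in favour of A0 and A2. Both
  groups of logarithms are then bounded by multiples of the sum \<rho>^2 of their squared moduli,
  and the sign of the net coefficient decides.\<close>

lemma equilateral_strict_local_minimum:
  assumes c: "c > 0" and r: "0 < r" "r < 1" and F2: "F2 c r < 0"
  obtains q0 where "q0 > 0"
    and "\<And>A0 A1 A2. (cmod A0)\<^sup>2 + (cmod A1)\<^sup>2 + (cmod A2)\<^sup>2 = r\<^sup>2 \<Longrightarrow>
      (cmod A0)\<^sup>2 + (cmod A2)\<^sup>2 < q0 \<Longrightarrow> A0 \<noteq> 0 \<or> A2 \<noteq> 0 \<Longrightarrow>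
      config_energy c (A0 + A1 + A2) (A0 + cube_root_unity * A1 + cnj cube_root_unity * A2)
        (A0 + cnj cube_root_unity * A1 + cube_root_unity * A2)
      > 3 * ln (1 - r\<^sup>2) - 3 * c * ln (3 * r\<^sup>2)"
proof -
  define \<nu> where "\<nu> = 1 / (1 - r\<^sup>2)"
  have r2: "0 < r\<^sup>2" "r\<^sup>2 < 1" using r by (auto simp: power_less_one_iff)
  have nu: "\<nu> > 0" using r2 by (simp add: \<nu>_def)
  \<comment> \<open>The coefficient of \<rho>^2 in the final lower bound, with \<eta> paying for the
    logarithm remainders, for terms of higher order in \<open>w\<close>, and for replacing the
    modulus of A1 by \<open>r\<close>. At zero it is a positive multiple of \<open>- F2 c r\<close>,
    so a small positive \<eta> keeps it positive by continuity.\<close>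
  define E where "E \<eta> = 3 * c * (1 - 2 * \<eta>) * (1 - \<eta>) / r\<^sup>2 - (3 + 6 * \<eta>) * (2 * r\<^sup>2 + \<eta>) * \<nu>\<^sup>2" for \<eta>
  have "E 0 = - F2 c r * (3 * \<nu>\<^sup>2 / r\<^sup>2)"
    using r2 by (simp add: E_def F2_def \<nu>_def divide_simps)
  moreover have "0 < - F2 c r * (3 * \<nu>\<^sup>2 / r\<^sup>2)"
    by (rule mult_pos_pos) (use F2 nu r in auto)
  ultimately have E0: "E 0 > 0" by simp
  have "eventually (\<lambda>\<eta>. - E \<eta> < 0) (nhds 0)"
    unfolding E_def by (rule eventually_less_at_zero) (use E0 r in \<open>auto simp: E_def intro!: continuous_intros\<close>)
  moreover have "eventually (\<lambda>\<eta>::real. \<eta> < 1/2) (nhds 0)"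
    by (rule eventually_less_at_zero) auto
  ultimately have "eventually (\<lambda>\<eta>. - E \<eta> < 0 \<and> \<eta> < 1/2) (at_right 0)"
    by (simp add: eventually_conj_iff eventually_nhds_conv_at eventually_at_split)
  then obtain \<eta> where eta: "E \<eta> > 0" "\<eta> < 1/2" "\<eta> > 0"
    using eventually_happens[OF eventually_conj[OF _ eventually_at_right_less]] by force
  obtain \<theta> where theta: "0 < \<theta>" "\<theta> < 1"
    and ln: "\<And>x. \<bar>x\<bar> < \<theta> \<Longrightarrow> \<bar>ln (1 + x) - (x - x\<^sup>2 / 2)\<bar> \<le> \<eta> * x\<^sup>2"
    using ln_one_plus_second_order[OF eta(3)] by blast
  \<comment> \<open>The first two conditions put the arguments \<open>x\<close> and \<open>y\<close>
    below into the range of the logarithm estimate, the third bounds \<open>w\<close>, and the last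
    gives that the squared modulus of A1 is at least (1 - \<eta>) r^2.\<close>
  have "eventually (\<lambda>\<rho>. 2 * \<nu> * (r * sqrt 2 * \<rho> + \<rho>\<^sup>2 / 2) < \<theta> \<and> (\<rho>\<^sup>2 + 2 * r * \<rho>) / r\<^sup>2 < \<theta>
      \<and> (r * sqrt 2 + \<rho> / 2)\<^sup>2 < 2 * r\<^sup>2 + \<eta> \<and> \<rho>\<^sup>2 < \<eta> * r\<^sup>2) (nhds 0)"
    by (intro eventually_conj eventually_less_at_zero continuous_intros)
      (use theta eta r in \<open>auto simp: power_mult_distrib\<close>)
  then obtain \<rho>0 where rho0: "\<rho>0 > 0" and rho: "\<And>\<rho>. \<bar>\<rho>\<bar> < \<rho>0 \<Longrightarrow>
      2 * \<nu> * (r * sqrt 2 * \<rho> + \<rho>\<^sup>2 / 2) < \<theta> \<and> (\<rho>\<^sup>2 + 2 * r * \<rho>) / r\<^sup>2 < \<theta>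
      \<and> (r * sqrt 2 + \<rho> / 2)\<^sup>2 < 2 * r\<^sup>2 + \<eta> \<and> \<rho>\<^sup>2 < \<eta> * r\<^sup>2"
    unfolding eventually_nhds_metric by (auto simp: dist_real_def)
  show thesis
  proof
    show "\<rho>0\<^sup>2 > 0" using rho0 by simp
    fix A0 A1 A2 :: complex
    assume S: "(cmod A0)\<^sup>2 + (cmod A1)\<^sup>2 + (cmod A2)\<^sup>2 = r\<^sup>2"
      and q: "(cmod A0)\<^sup>2 + (cmod A2)\<^sup>2 < \<rho>0\<^sup>2" and ne: "A0 \<noteq> 0 \<or> A2 \<noteq> 0"
    define a0 a1 a2 where "a0 = cmod A0" and "a1 = cmod A1" and "a2 = cmod A2"
    note a_defs = a0_def a1_def a2_def
    define \<rho> where "\<rho> = sqrt (a0\<^sup>2 + a2\<^sup>2)"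
    have rho2: "\<rho>\<^sup>2 = a0\<^sup>2 + a2\<^sup>2" and rho_nn: "\<rho> \<ge> 0" by (simp_all add: \<rho>_def)
    have "\<rho>\<^sup>2 < \<rho>0\<^sup>2" using q by (simp add: rho2 a_defs)
    then have "\<bar>\<rho>\<bar> < \<rho>0" using rho0 rho_nn by (simp add: power2_less_imp_less)
    note small = rho[OF this]
    have a_nn: "a0 \<ge> 0" "a1 \<ge> 0" "a2 \<ge> 0" by (simp_all add: a_defs)
    have a1_sq: "a1\<^sup>2 = r\<^sup>2 - \<rho>\<^sup>2" using S by (simp add: rho2 a_defs)
    have a1_le: "a1 \<le> r" by (rule power2_le_imp_le) (use a1_sq r in auto)
    have a2_le: "a2 \<le> \<rho>" by (rule power2_le_imp_le) (use rho2 rho_nn in auto)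
    \<comment> \<open>Cauchy-Schwarz; squared, it produces the factor 2 in
      \<open>F2\<close>.\<close>
    have a0a2: "a0 + a2 \<le> sqrt 2 * \<rho>"
    proof (rule power2_le_imp_le)
      have "(a0 + a2)\<^sup>2 + (a0 - a2)\<^sup>2 = 2 * \<rho>\<^sup>2" unfolding rho2 by algebra
      moreover have "(sqrt 2 * \<rho>)\<^sup>2 = 2 * \<rho>\<^sup>2" by (simp add: power_mult_distrib)
      ultimately show "(a0 + a2)\<^sup>2 \<le> (sqrt 2 * \<rho>)\<^sup>2"
        using zero_le_power2[of "a0 - a2"] by linarith
    qed (use rho_nn in auto)
    have a0_a2: "a0 * a2 \<le> \<rho>\<^sup>2 / 2"
    proof -
      have "\<rho>\<^sup>2 - 2 * (a0 * a2) = (a0 - a2)\<^sup>2" unfolding rho2 by algebra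
      then show ?thesis using zero_le_power2[of "a0 - a2"] by linarith
    qed
    define w where "w = A0 * cnj A1 + cnj A0 * A2 + A1 * cnj A2"
    define v where "v = A1 * cnj A2"
    let ?\<omega> = cube_root_unity
    have "cmod w \<le> a0 * a1 + a0 * a2 + a1 * a2"
      unfolding w_def a_defs
      by (rule order_trans[OF norm_triangle_ineq] add_mono order_refl norm_triangle_ineq[THEN order_trans]
          | simp add: norm_mult)+
    also have "\<dots> = a1 * (a0 + a2) + a0 * a2" by (simp add: algebra_simps)
    also have "\<dots> \<le> r * (sqrt 2 * \<rho>) + \<rho>\<^sup>2 / 2"
      by (intro add_mono mult_mono a1_le a0a2 a0_a2) (use r a_nn in auto)
    finally have w_le: "cmod w \<le> r * sqrt 2 * \<rho> + \<rho>\<^sup>2 / 2" by (simp add: mult.assoc)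
    then have "(cmod w)\<^sup>2 \<le> (r * sqrt 2 * \<rho> + \<rho>\<^sup>2 / 2)\<^sup>2" by (simp add: power_mono)
    also have "\<dots> = \<rho>\<^sup>2 * (r * sqrt 2 + \<rho> / 2)\<^sup>2" by (simp add: power2_eq_square algebra_simps)
    also have "\<dots> \<le> \<rho>\<^sup>2 * (2 * r\<^sup>2 + \<eta>)" using small by (intro mult_left_mono) auto
    finally have w_sq: "(cmod w)\<^sup>2 \<le> \<rho>\<^sup>2 * (2 * r\<^sup>2 + \<eta>)" .
    have v_norm: "cmod v = a1 * a2" by (simp add: v_def a_defs norm_mult)
    have v_le: "cmod v \<le> r * \<rho>" unfolding v_norm
      by (intro mult_mono a1_le a2_le) (use r a_nn in auto)
    have Re_le: "\<bar>Re u\<bar> \<le> cmod u" "\<bar>Re (?\<omega> * u)\<bar> \<le> cmod u" "\<bar>Re (cnj ?\<omega> * u)\<bar> \<le> cmod u" for u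
      using abs_Re_le_cmod[of u] abs_Re_le_cmod[of "?\<omega> * u"] abs_Re_le_cmod[of "cnj ?\<omega> * u"]
      by (simp_all add: norm_mult norm_cube_root_unity)

    \<comment> \<open>Relative deviation of 1 minus a squared modulus from its equilibrium value;
      \<open>u\<close> is the phase belonging to the vertex.\<close>
    define x where "x u = - (2 * \<nu> * Re (u * w))" for u
    have x_small: "\<bar>x u\<bar> < \<theta>" if "u \<in> {1, ?\<omega>, cnj ?\<omega>}" for u
    proof -
      have "\<bar>x u\<bar> = 2 * \<nu> * \<bar>Re (u * w)\<bar>" using nu by (simp add: x_def abs_mult)
      also have "\<dots> \<le> 2 * \<nu> * (r * sqrt 2 * \<rho> + \<rho>\<^sup>2 / 2)"
        by (rule mult_left_mono, rule order_trans[OF _ w_le]) (use that Re_le nu in auto)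
      also have "\<dots> < \<theta>" using small by blast
      finally show ?thesis .
    qed
    have sum_x: "x 1 + x (cnj ?\<omega>) + x ?\<omega> = 0"
    proof -
      have "x 1 + x (cnj ?\<omega>) + x ?\<omega> = - (2 * \<nu>) * (Re w + Re (?\<omega> * w) + Re (cnj ?\<omega> * w))"
        by (simp add: x_def algebra_simps)
      then show ?thesis by (simp only: cube_root_unity_Re_sums mult_zero_right)
    qed
    have sum_x2: "(x 1)\<^sup>2 + (x (cnj ?\<omega>))\<^sup>2 + (x ?\<omega>)\<^sup>2 = 6 * \<nu>\<^sup>2 * (cmod w)\<^sup>2"
    proof -
      have "(x 1)\<^sup>2 + (x (cnj ?\<omega>))\<^sup>2 + (x ?\<omega>)\<^sup>2
          = 4 * \<nu>\<^sup>2 * ((Re w)\<^sup>2 + (Re (?\<omega> * w))\<^sup>2 + (Re (cnj ?\<omega> * w))\<^sup>2)"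
        unfolding x_def mult_1_left by algebra
      then show ?thesis unfolding cube_root_unity_Re_sums by simp
    qed
    have x_eq: "1 - (r\<^sup>2 + 2 * Re (u * w)) = (1 - r\<^sup>2) * (1 + x u)" for u
      using r2 by (simp add: x_def \<nu>_def field_simps)
    have "\<bar>ln ((1 - r\<^sup>2) * (1 + x 1)) + ln ((1 - r\<^sup>2) * (1 + x (cnj ?\<omega>))) + ln ((1 - r\<^sup>2) * (1 + x ?\<omega>))
        - 3 * ln (1 - r\<^sup>2) - (0 - 6 * \<nu>\<^sup>2 * (cmod w)\<^sup>2 / 2)\<bar> \<le> \<eta> * (6 * \<nu>\<^sup>2 * (cmod w)\<^sup>2)"
      by (rule ln_affine_triple_sum[OF ln theta(2) x_small x_small x_small _ sum_x sum_x2]) (use r2 in auto)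
    then have "ln ((1 - r\<^sup>2) * (1 + x 1)) + ln ((1 - r\<^sup>2) * (1 + x (cnj ?\<omega>))) + ln ((1 - r\<^sup>2) * (1 + x ?\<omega>))
        - 3 * ln (1 - r\<^sup>2) \<ge> - ((3 + 6 * \<eta>) * \<nu>\<^sup>2 * (cmod w)\<^sup>2)"
      by (simp add: abs_le_iff algebra_simps)
    moreover have "(3 + 6 * \<eta>) * \<nu>\<^sup>2 * (cmod w)\<^sup>2 \<le> (3 + 6 * \<eta>) * \<nu>\<^sup>2 * (\<rho>\<^sup>2 * (2 * r\<^sup>2 + \<eta>))"
      by (rule mult_left_mono[OF w_sq]) (use eta in auto)
    ultimately have part1:
      "ln ((1 - r\<^sup>2) * (1 + x 1)) + ln ((1 - r\<^sup>2) * (1 + x (cnj ?\<omega>))) + ln ((1 - r\<^sup>2) * (1 + x ?\<omega>))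
        - 3 * ln (1 - r\<^sup>2) \<ge> - (\<rho>\<^sup>2 * ((3 + 6 * \<eta>) * (2 * r\<^sup>2 + \<eta>) * \<nu>\<^sup>2))"
      by (simp add: mult_ac)

    \<comment> \<open>Relative deviation of a squared distance from 3 r^2. After summing over the
      sides, A0 enters at first order in \<open>y\<close>, whereas A2 contributes only through the
      squares.\<close>
    define y where "y u = - ((a0\<^sup>2 + 2 * Re (u * v)) / r\<^sup>2)" for u
    have y_small: "\<bar>y u\<bar> < \<theta>" if "u \<in> {1, ?\<omega>, cnj ?\<omega>}" for u
    proof -
      have "\<bar>Re (u * v)\<bar> \<le> r * \<rho>"
        by (rule order_trans[OF _ v_le]) (use that Re_le in auto)
      moreover have "a0\<^sup>2 \<le> \<rho>\<^sup>2" using rho2 by simp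
      ultimately have "\<bar>a0\<^sup>2 + 2 * Re (u * v)\<bar> \<le> \<rho>\<^sup>2 + 2 * r * \<rho>"
        using zero_le_power2[of a0] unfolding abs_le_iff mult.assoc by linarith
      then have "\<bar>y u\<bar> \<le> (\<rho>\<^sup>2 + 2 * r * \<rho>) / r\<^sup>2"
        using r2 by (simp add: y_def divide_right_mono)
      then show ?thesis using small by linarith
    qed
    have sum_y: "y ?\<omega> + y (cnj ?\<omega>) + y 1 = - (3 * a0\<^sup>2 / r\<^sup>2)"
    proof -
      have "y ?\<omega> + y (cnj ?\<omega>) + y 1 = - ((3 * a0\<^sup>2 + 2 * (Re v + Re (?\<omega> * v) + Re (cnj ?\<omega> * v))) / r\<^sup>2)"
        unfolding y_def mult_1_left by (simp only: minus_add_distrib[symmetric] add_divide_distrib[symmetric]) (simp add: algebra_simps)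
      then show ?thesis unfolding cube_root_unity_Re_sums by simp
    qed
    have sum_y2: "(y ?\<omega>)\<^sup>2 + (y (cnj ?\<omega>))\<^sup>2 + (y 1)\<^sup>2 = (3 * a0^4 + 6 * (a1 * a2)\<^sup>2) / r^4"
    proof -
      have ysq: "(y u)\<^sup>2 = (a0\<^sup>2 + 2 * Re (u * v))\<^sup>2 / r^4" for u
        unfolding y_def power2_minus power_divide by simp
      have "(y ?\<omega>)\<^sup>2 + (y (cnj ?\<omega>))\<^sup>2 + (y 1)\<^sup>2 =
        ((a0\<^sup>2 + 2 * Re (?\<omega> * v))\<^sup>2 + (a0\<^sup>2 + 2 * Re (cnj ?\<omega> * v))\<^sup>2 + (a0\<^sup>2 + 2 * Re v)\<^sup>2) / r^4"
        unfolding ysq mult_1_left by (simp only: add_divide_distrib)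
      also have "(a0\<^sup>2 + 2 * Re (?\<omega> * v))\<^sup>2 + (a0\<^sup>2 + 2 * Re (cnj ?\<omega> * v))\<^sup>2 + (a0\<^sup>2 + 2 * Re v)\<^sup>2
        = 3 * a0^4 + 4 * a0\<^sup>2 * (Re v + Re (?\<omega> * v) + Re (cnj ?\<omega> * v))
          + 4 * ((Re v)\<^sup>2 + (Re (?\<omega> * v))\<^sup>2 + (Re (cnj ?\<omega> * v))\<^sup>2)"
        by algebra
      finally show ?thesis unfolding cube_root_unity_Re_sums v_norm by simp
    qed
    have y_eq: "3 * ((r\<^sup>2 - a0\<^sup>2) - 2 * Re (u * v)) = (3 * r\<^sup>2) * (1 + y u)" for u
      using r2 by (simp add: y_def field_simps)
    define Y where "Y = ln ((3 * r\<^sup>2) * (1 + y ?\<omega>)) + ln ((3 * r\<^sup>2) * (1 + y (cnj ?\<omega>)))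
        + ln ((3 * r\<^sup>2) * (1 + y 1)) - 3 * ln (3 * r\<^sup>2)"
    define s2 where "s2 = (3 * a0^4 + 6 * (a1 * a2)\<^sup>2) / r^4"
    have "\<bar>Y - (- (3 * a0\<^sup>2 / r\<^sup>2) - s2 / 2)\<bar> \<le> \<eta> * s2"
      unfolding Y_def s2_def
      by (rule ln_affine_triple_sum[OF ln theta(2) y_small y_small y_small _ sum_y sum_y2]) (use r2 in auto)
    then have Y1: "- Y \<ge> 3 * a0\<^sup>2 / r\<^sup>2 + (1 / 2 - \<eta>) * s2"
      by (simp add: abs_le_iff algebra_simps)
    have "6 * (1 - \<eta>) * a2\<^sup>2 / r\<^sup>2 \<le> s2"
    proof -
      have "r\<^sup>2 * (1 - \<eta>) \<le> a1\<^sup>2" using small a1_sq by (simp add: algebra_simps)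
      then have "6 * (r\<^sup>2 * (1 - \<eta>)) * a2\<^sup>2 \<le> 6 * a1\<^sup>2 * a2\<^sup>2"
        by (intro mult_right_mono) auto
      also have "\<dots> \<le> 3 * a0^4 + 6 * (a1 * a2)\<^sup>2" by (simp add: power_mult_distrib)
      finally have "6 * (r\<^sup>2 * (1 - \<eta>)) * a2\<^sup>2 / r^4 \<le> s2"
        unfolding s2_def by (rule divide_right_mono) simp
      moreover have "6 * (r\<^sup>2 * (1 - \<eta>)) * a2\<^sup>2 / r^4 = 6 * (1 - \<eta>) * a2\<^sup>2 / r\<^sup>2"
        using r by (simp add: field_simps power_numeral_reduce)
      ultimately show ?thesis by simp
    qed
    then have "(1 / 2 - \<eta>) * (6 * (1 - \<eta>) * a2\<^sup>2 / r\<^sup>2) \<le> (1 / 2 - \<eta>) * s2"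
      by (rule mult_left_mono) (use eta in auto)
    moreover have "(1 / 2 - \<eta>) * (6 * (1 - \<eta>) * a2\<^sup>2 / r\<^sup>2) = 3 * ((1 - 2 * \<eta>) * (1 - \<eta>)) * a2\<^sup>2 / r\<^sup>2"
    proof -
      have "(1 / 2 - \<eta>) * 6 = 3 * (1 - 2 * \<eta>)" by (simp add: algebra_simps)
      then have "(1 / 2 - \<eta>) * 6 * ((1 - \<eta>) * a2\<^sup>2 / r\<^sup>2) = 3 * (1 - 2 * \<eta>) * ((1 - \<eta>) * a2\<^sup>2 / r\<^sup>2)"
        by (rule arg_cong)
      then show ?thesis by (simp only: times_divide_eq_right mult.assoc)
    qed
    \<comment> \<open>Weakening the A0 coefficient to that of A2 lets both terms combine into a
      multiple of \<rho>^2.\<close>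
    moreover have "3 * ((1 - 2 * \<eta>) * (1 - \<eta>)) * a0\<^sup>2 / r\<^sup>2 \<le> 3 * a0\<^sup>2 / r\<^sup>2"
    proof -
      have "(1 - 2 * \<eta>) * (1 - \<eta>) \<le> 1" using eta by (intro mult_le_one) auto
      then show ?thesis by (intro divide_right_mono mult_right_mono) auto
    qed
    ultimately have "- Y \<ge> 3 * ((1 - 2 * \<eta>) * (1 - \<eta>)) * a0\<^sup>2 / r\<^sup>2 + 3 * ((1 - 2 * \<eta>) * (1 - \<eta>)) * a2\<^sup>2 / r\<^sup>2"
      using Y1 by linarith
    also have "3 * ((1 - 2 * \<eta>) * (1 - \<eta>)) * a0\<^sup>2 / r\<^sup>2 + 3 * ((1 - 2 * \<eta>) * (1 - \<eta>)) * a2\<^sup>2 / r\<^sup>2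
        = \<rho>\<^sup>2 * (3 * ((1 - 2 * \<eta>) * (1 - \<eta>)) / r\<^sup>2)"
    proof -
      have "k * s / d + k * t / d = (s + t) * (k / d)" for k s t d :: real
        by (simp add: divide_inverse algebra_simps)
      then show ?thesis unfolding rho2 .
    qed
    finally have "c * (\<rho>\<^sup>2 * (3 * ((1 - 2 * \<eta>) * (1 - \<eta>)) / r\<^sup>2)) \<le> c * - Y"
      using c by (intro mult_left_mono) auto
    then have part2: "- (c * Y) \<ge> \<rho>\<^sup>2 * (3 * c * (1 - 2 * \<eta>) * (1 - \<eta>) / r\<^sup>2)"
      by (simp add: mult_ac)

    have energy: "config_energy c (A0 + A1 + A2) (A0 + ?\<omega> * A1 + cnj ?\<omega> * A2) (A0 + cnj ?\<omega> * A1 + ?\<omega> * A2)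
      = ln ((1 - r\<^sup>2) * (1 + x 1)) + ln ((1 - r\<^sup>2) * (1 + x (cnj ?\<omega>))) + ln ((1 - r\<^sup>2) * (1 + x ?\<omega>))
        - c * (Y + 3 * ln (3 * r\<^sup>2))"
    proof -
      have "(cmod A1)\<^sup>2 + (cmod A2)\<^sup>2 = r\<^sup>2 - a0\<^sup>2" using S by (simp add: a_defs)
      then show ?thesis
        unfolding config_energy_def fourier_config_modulus[of A0 A1 A2]
          fourier_config_distance[of A0 A1 A2] S
        unfolding w_def[symmetric]
        unfolding v_def[symmetric]
        by (simp add: x_eq[symmetric] y_eq[symmetric] Y_def)
    qed
    have "\<rho>\<^sup>2 > 0" using ne unfolding rho2 a_defs by (simp add: sum_power2_gt_zero_iff)
    then have "\<rho>\<^sup>2 * E \<eta> > 0" using eta(1) by simp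
    then have "\<rho>\<^sup>2 * (3 * c * (1 - 2 * \<eta>) * (1 - \<eta>) / r\<^sup>2) - \<rho>\<^sup>2 * ((3 + 6 * \<eta>) * (2 * r\<^sup>2 + \<eta>) * \<nu>\<^sup>2) > 0"
      unfolding E_def by (simp only: right_diff_distrib)
    moreover have "c * (Y + 3 * ln (3 * r\<^sup>2)) = c * Y + 3 * c * ln (3 * r\<^sup>2)" by (simp add: algebra_simps)
    ultimately show "config_energy c (A0 + A1 + A2) (A0 + ?\<omega> * A1 + cnj ?\<omega> * A2)
        (A0 + cnj ?\<omega> * A1 + ?\<omega> * A2) > 3 * ln (1 - r\<^sup>2) - 3 * c * ln (3 * r\<^sup>2)"
      unfolding energy using part1 part2 by linarith
  qed
qed

section \<open>Gradient of the vortex Hamiltonian\<close>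

lemma matrix_mult_scaleR_left: "(a *\<^sub>R A) ** B = a *\<^sub>R (A ** B)"
  for A :: "complex^'n^'m" and B :: "complex^'k^'n"
  by (simp add: vec_eq_iff matrix_matrix_mult_def scaleR_sum_right)

lemma matrix_mult_scaleR_right: "A ** (a *\<^sub>R B) = a *\<^sub>R (A ** B)"
  for A :: "complex^'n^'m" and B :: "complex^'k^'n"
  by (simp add: vec_eq_iff matrix_matrix_mult_def scaleR_sum_right)

lemma bounded_bilinear_matrix_mult:
  "bounded_bilinear ((**) :: complex^'n^'m \<Rightarrow> complex^'k^'n \<Rightarrow> complex^'k^'m)"
  unfolding bilinear_conv_bounded_bilinear[symmetric] bilinear_def
  by (auto intro!: linearI simp: matrix_add_ldistrib matrix_mult_scaleR_left matrix_mult_scaleR_right)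
    (simp add: matrix_matrix_mult_def vec_eq_iff distrib_right sum.distrib)

lemma ctranspose_mult: "ctranspose (A ** B) = ctranspose B ** ctranspose A"
  by (simp add: ctranspose_def matrix_matrix_mult_def vec_eq_iff mult.commute)

lemma linear_ctranspose: "linear ctranspose"
  by (rule linearI) (simp_all add: ctranspose_def vec_eq_iff)

lemma subspace_skew_hermitian: "subspace skew_hermitian"
  unfolding subspace_def skew_hermitian_def
  by (auto simp: linear_add[OF linear_ctranspose] linear_cmul[OF linear_ctranspose] linear_0[OF linear_ctranspose])

lemma skew_inner_eq_inner: "skew_inner \<xi> \<eta> = (\<xi> \<bullet> \<eta>) / 2"
proof -
  have "Re (trace (ctranspose \<xi> ** \<eta>)) = (\<Sum>i\<in>UNIV. \<Sum>k\<in>UNIV. \<xi> $ k $ i \<bullet> \<eta> $ k $ i)"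
    by (simp add: trace_def matrix_matrix_mult_def ctranspose_def inner_complex_def)
  also have "\<dots> = \<xi> \<bullet> \<eta>"
    unfolding inner_vec_def by (rule sum.swap)
  finally show ?thesis by (simp add: skew_inner_def)
qed

lemma inner_matrix_eq_trace: "\<xi> \<bullet> \<eta> = Re (trace (ctranspose \<xi> ** \<eta>))"
  for \<xi> \<eta> :: "complex^'n^'n"
  using skew_inner_eq_inner[of \<xi> \<eta>] by (simp add: skew_inner_def)

text \<open>The infinitesimal form of the invariance of the trace pairing under unitary conjugation,
  proved by cyclicity of the trace. Conservation of energy and of the residual norm both rest on
  it.\<close>

lemma commutator_inner:
  fixes A B C :: "complex^'n^'n"
  assumes "A \<in> skew_hermitian"
  shows "(A ** B - B ** A) \<bullet> C = - (B \<bullet> (A ** C - C ** A))"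
proof -
  have A: "ctranspose A = - A" using assms by (simp add: skew_hermitian_def)
  have "(A ** B) \<bullet> C = B \<bullet> (ctranspose A ** C)"
    by (simp add: inner_matrix_eq_trace ctranspose_mult matrix_mul_assoc)
  moreover have "(B ** A) \<bullet> C = B \<bullet> (C ** ctranspose A)"
  proof -
    have "trace (ctranspose A ** (ctranspose B ** C)) = trace (ctranspose B ** C ** ctranspose A)"
      by (rule trace_mul_sym)
    then show ?thesis
      by (simp add: inner_matrix_eq_trace ctranspose_mult matrix_mul_assoc)
  qed
  moreover have "(- A) ** C = - (A ** C)" "C ** (- A) = - (C ** A)"
    using matrix_mult_scaleR_left[of "-1" A C] matrix_mult_scaleR_right[of C "-1" A] by simp_all
  ultimately show ?thesis by (simp add: A inner_diff_left inner_diff_right)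
qed

lemma commutator_skew_hermitian:
  fixes A B :: "complex^'n^'n"
  assumes "A \<in> skew_hermitian" "B \<in> skew_hermitian"
  shows "A ** B - B ** A \<in> skew_hermitian"
proof -
  have "(- X) ** (- Y) = X ** Y" for X Y :: "complex^'n^'n"
    using matrix_mult_scaleR_left[of "-1" X "-Y"] matrix_mult_scaleR_right[of X "-1" Y] by simp
  then show ?thesis
    using assms
    by (simp add: skew_hermitian_def linear_diff[OF linear_ctranspose] ctranspose_mult)
qed

section \<open>The Hamiltonian as a sum of logarithms of affine functions\<close>

text \<open>A pair (i, i) stands for the boundary term of vortex i and the other pairs for mutual
  distances. Domain, Hamiltonian and gradient thus become uniform expressions over one index
  set.\<close>

definition log_pairs :: "(3 \<times> 3) set" where
  "log_pairs = {(1, 1), (2, 2), (3, 3)} \<union> index_pairs"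

definition log_linear_part :: "complex^3^3 \<Rightarrow> 3 \<times> 3 \<Rightarrow> real" where
  "log_linear_part \<mu> = (\<lambda>(i, j). if i = j then - mu_diag \<mu> i else sqdist \<mu> i j)"

definition log_arg :: "complex^3^3 \<Rightarrow> 3 \<times> 3 \<Rightarrow> real" where
  "log_arg \<mu> k = of_bool (fst k = snd k) + log_linear_part \<mu> k"

definition log_weight :: "real \<Rightarrow> real^3 \<Rightarrow> 3 \<times> 3 \<Rightarrow> real" where
  "log_weight c \<Gamma> = (\<lambda>(i, j). (if i = j then 1 else - c) * \<Gamma> $ i * \<Gamma> $ j / 2)"

text \<open>The matrix representing \<open>log_linear_part\<close> with respect to \<open>skew_inner\<close>.\<close>

definition log_gradient :: "3 \<times> 3 \<Rightarrow> complex^3^3" where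
  "log_gradient = (\<lambda>(i, j). \<chi> k l. \<i> * (if i = j then - 2 * of_bool (k = i \<and> l = i)
     else 2 * (of_bool (k = i) - of_bool (k = j)) * (of_bool (l = i) - of_bool (l = j))))"

lemma finite_log_pairs: "finite log_pairs"
  by (simp add: log_pairs_def index_pairs_def)

lemma vortex_domain_eq:
  "vortex_domain = {\<mu> \<in> skew_hermitian. \<forall>k\<in>log_pairs. log_arg \<mu> k > 0}"
  by (auto simp: vortex_domain_def log_pairs_def index_pairs_def log_arg_def log_linear_part_def
      forall_3 ball_Un)

lemma vortex_ham_eq: "vortex_ham c \<Gamma> \<mu> = (\<Sum>k\<in>log_pairs. log_weight c \<Gamma> k * ln (log_arg \<mu> k))"
  by (simp add: vortex_ham_def log_pairs_def index_pairs_def log_arg_def log_linear_part_def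
      log_weight_def sum_3 power2_eq_square field_simps)

lemma bounded_linear_log_linear_part: "bounded_linear (\<lambda>\<mu>. log_linear_part \<mu> k)"
  unfolding linear_conv_bounded_linear[symmetric]
  by (rule linearI)
    (auto simp: log_linear_part_def sqdist_def mu_diag_def mu_off_def herm_def algebra_simps split: prod.splits)

lemma log_gradient_skew: "log_gradient k \<in> skew_hermitian"
  by (auto simp: log_gradient_def skew_hermitian_def ctranspose_def vec_eq_iff split: prod.splits)

lemma skew_hermitian_component: "\<mu> \<in> skew_hermitian \<Longrightarrow> \<mu> $ i $ j = - cnj (\<mu> $ j $ i)"
  unfolding skew_hermitian_def ctranspose_def
  by (simp add: vec_eq_iff)

lemma log_linear_part_eq_skew_inner:
  assumes "\<nu> \<in> skew_hermitian" and "k \<in> log_pairs"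
  shows "log_linear_part \<nu> k = skew_inner \<nu> (log_gradient k)"
proof -
  \<comment> \<open>\<open>sqdist\<close> reads only the entry above the diagonal, the inner product
    both; their imaginary parts agree.\<close>
  have Im: "Im (\<nu> $ i $ j) = Im (\<nu> $ j $ i)" for i j
    using skew_hermitian_component[OF assms(1), of i j] by simp
  show ?thesis
    using assms(2) Im[of 2 1] Im[of 3 1] Im[of 3 2]
    by (auto simp: skew_inner_eq_inner inner_vec_def inner_complex_def sum_3 log_gradient_def
        log_pairs_def index_pairs_def log_linear_part_def sqdist_def mu_diag_def mu_off_def herm_def)
qed

definition ham_gradient :: "real \<Rightarrow> real^3 \<Rightarrow> complex^3^3 \<Rightarrow> complex^3^3" where
  "ham_gradient c \<Gamma> \<mu> = (\<Sum>k\<in>log_pairs. (log_weight c \<Gamma> k / log_arg \<mu> k) *\<^sub>R log_gradient k)"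

lemma ham_gradient_skew: "ham_gradient c \<Gamma> \<mu> \<in> skew_hermitian"
  unfolding ham_gradient_def
  by (intro subspace_sum subspace_scale subspace_skew_hermitian log_gradient_skew)

text \<open>Stated for an arbitrary curve so that it covers both the straight lines in
  \<open>func_deriv\<close> and the solutions in the conservation law.\<close>

lemma vortex_ham_has_derivative_along:
  assumes x: "(x has_vector_derivative v) (at t within J)" and dom: "x t \<in> vortex_domain"
    and v: "v \<in> skew_hermitian"
  shows "((\<lambda>s. vortex_ham c \<Gamma> (x s)) has_real_derivative skew_inner v (ham_gradient c \<Gamma> (x t))) (at t within J)"
proof -
  have arg: "((\<lambda>s. log_arg (x s) k) has_real_derivative log_linear_part v k) (at t within J)" for k
    using bounded_linear.has_vector_derivative[OF bounded_linear_log_linear_part x, of k]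
    unfolding log_arg_def has_real_derivative_iff_has_vector_derivative
    by (auto intro!: derivative_eq_intros)
  have "((\<lambda>s. log_weight c \<Gamma> k * ln (log_arg (x s) k)) has_real_derivative
      log_weight c \<Gamma> k * (1 / log_arg (x t) k * log_linear_part v k)) (at t within J)"
    if "k \<in> log_pairs" for k
    by (rule DERIV_cmult, rule DERIV_chain2[OF DERIV_ln_divide arg])
      (use dom that in \<open>auto simp: vortex_domain_eq\<close>)
  then have "((\<lambda>s. vortex_ham c \<Gamma> (x s)) has_real_derivative
      (\<Sum>k\<in>log_pairs. log_weight c \<Gamma> k * (1 / log_arg (x t) k * log_linear_part v k))) (at t within J)"
    unfolding vortex_ham_eq by (rule DERIV_sum)
  also have "(\<Sum>k\<in>log_pairs. log_weight c \<Gamma> k * (1 / log_arg (x t) k * log_linear_part v k))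
      = skew_inner v (ham_gradient c \<Gamma> (x t))"
    unfolding ham_gradient_def
    by (simp add: skew_inner_eq_inner inner_sum_right sum_divide_distrib log_linear_part_eq_skew_inner[OF v])
  finally show ?thesis .
qed

lemma func_deriv_vortex_ham:
  assumes "\<mu> \<in> vortex_domain"
  shows "func_deriv (vortex_ham c \<Gamma>) \<mu> = ham_gradient c \<Gamma> \<mu>"
  unfolding func_deriv_def
proof (rule the_equality)
  have der: "((\<lambda>s::real. vortex_ham c \<Gamma> (\<mu> + s *\<^sub>R \<nu>)) has_real_derivative skew_inner \<nu> (ham_gradient c \<Gamma> \<mu>)) (at 0)"
    if "\<nu> \<in> skew_hermitian" for \<nu>
  proof -
    have "((\<lambda>s. \<mu> + s *\<^sub>R \<nu>) has_vector_derivative \<nu>) (at 0)"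
      unfolding has_vector_derivative_def by (auto intro!: derivative_eq_intros)
    from vortex_ham_has_derivative_along[OF this _ that, of c \<Gamma>] assms show ?thesis by simp
  qed
  then show "ham_gradient c \<Gamma> \<mu> \<in> skew_hermitian \<and> (\<forall>\<nu>\<in>skew_hermitian.
      ((\<lambda>s::real. vortex_ham c \<Gamma> (\<mu> + s *\<^sub>R \<nu>)) has_real_derivative skew_inner \<nu> (ham_gradient c \<Gamma> \<mu>)) (at 0))"
    using ham_gradient_skew by blast
  fix g assume g: "g \<in> skew_hermitian \<and> (\<forall>\<nu>\<in>skew_hermitian.
      ((\<lambda>s::real. vortex_ham c \<Gamma> (\<mu> + s *\<^sub>R \<nu>)) has_real_derivative skew_inner \<nu> g) (at 0))"
  \<comment> \<open>Testing both candidates in the direction of their own difference gives it norm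
    zero.\<close>
  define \<nu> where "\<nu> = g - ham_gradient c \<Gamma> \<mu>"
  have "\<nu> \<in> skew_hermitian"
    unfolding \<nu>_def using g ham_gradient_skew subspace_diff[OF subspace_skew_hermitian] by blast
  then have "skew_inner \<nu> g = skew_inner \<nu> (ham_gradient c \<Gamma> \<mu>)"
    using g der DERIV_unique by blast
  then have "\<nu> \<bullet> \<nu> = 0"
    by (simp add: skew_inner_eq_inner \<nu>_def inner_diff_right)
  then show "g = ham_gradient c \<Gamma> \<mu>" by (simp add: \<nu>_def)
qed

lemma matrix_inv_circ_matrix_equal:
  assumes "\<And>i. \<Gamma> $ i = \<gamma>" and "\<gamma> \<noteq> 0"
  shows "matrix_inv (circ_matrix \<Gamma>) = (1 / \<gamma>) *\<^sub>R mat 1"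
proof -
  have c: "circ_matrix \<Gamma> = \<gamma> *\<^sub>R mat 1"
    by (auto simp: circ_matrix_def mat_def vec_eq_iff assms(1) of_real_def)
  define A where "A = circ_matrix \<Gamma>"
  define B :: "complex^3^3" where "B = (1 / \<gamma>) *\<^sub>R mat 1"
  have B: "A ** B = mat 1" "B ** A = mat 1"
    using assms(2) by (simp_all add: A_def B_def c matrix_mult_scaleR_left matrix_mult_scaleR_right)
  then have "A ** B = mat 1 \<and> B ** A = mat 1" ..
  then have "A ** matrix_inv A = mat 1 \<and> matrix_inv A ** A = mat 1"
    unfolding matrix_inv_def by (rule someI[of _ B])
  then have "B ** (A ** matrix_inv A) = B" by simp
  then have "matrix_inv A = B" unfolding matrix_mul_assoc B(2) by simp
  then show ?thesis unfolding A_def B_def .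
qed

lemma relative_field_equal_circulations:
  fixes c :: real
  assumes "\<And>i. \<Gamma> $ i = \<gamma>" and "\<gamma> \<noteq> 0" and "\<mu> \<in> vortex_domain"
  defines "G \<equiv> (1 / \<gamma>) *\<^sub>R ham_gradient c \<Gamma> \<mu>"
  shows "relative_field c \<Gamma> \<mu> = G ** \<mu> - \<mu> ** G"
  unfolding relative_field_def func_deriv_vortex_ham[OF assms(3)] matrix_inv_circ_matrix_equal[OF assms(1,2)] G_def
  by (simp add: matrix_mult_scaleR_left matrix_mult_scaleR_right)

section \<open>Conservation laws of the relative dynamics\<close>

lemma lipschitz_on_scaleR_bounded:
  fixes \<phi> :: "'a::metric_space \<Rightarrow> real" and \<psi> :: "'a \<Rightarrow> 'b::real_normed_vector"
  assumes \<phi>: "L-lipschitz_on K \<phi>" "\<And>x. x \<in> K \<Longrightarrow> \<bar>\<phi> x\<bar> \<le> A" and \<psi>: "M-lipschitz_on K \<psi>" "\<And>x. x \<in> K \<Longrightarrow> norm (\<psi> x) \<le> B"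
    and "A \<ge> 0" "B \<ge> 0"
  shows "(A * M + L * B)-lipschitz_on K (\<lambda>x. \<phi> x *\<^sub>R \<psi> x)"
proof (rule lipschitz_onI)
  fix x y assume xy: "x \<in> K" "y \<in> K"
  have "\<phi> x *\<^sub>R \<psi> x - \<phi> y *\<^sub>R \<psi> y = \<phi> x *\<^sub>R (\<psi> x - \<psi> y) + (\<phi> x - \<phi> y) *\<^sub>R \<psi> y"
    by (simp add: algebra_simps)
  then have "dist (\<phi> x *\<^sub>R \<psi> x) (\<phi> y *\<^sub>R \<psi> y) \<le> \<bar>\<phi> x\<bar> * dist (\<psi> x) (\<psi> y) + dist (\<phi> x) (\<phi> y) * norm (\<psi> y)"
    by (metis dist_norm norm_scaleR norm_triangle_ineq real_norm_def)
  also have "\<dots> \<le> A * (M * dist x y) + (L * dist x y) * B"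
    by (intro add_mono mult_mono lipschitz_onD[OF \<phi>(1)] lipschitz_onD[OF \<psi>(1)] \<phi>(2) \<psi>(2))
      (use xy assms lipschitz_on_nonneg[OF \<phi>(1)] in auto)
  finally show "dist (\<phi> x *\<^sub>R \<psi> x) (\<phi> y *\<^sub>R \<psi> y) \<le> (A * M + L * B) * dist x y"
    by (simp add: algebra_simps)
qed (use assms lipschitz_on_nonneg[OF \<phi>(1)] lipschitz_on_nonneg[OF \<psi>(1)] in auto)

lemma lipschitz_on_inverse_real:
  fixes f :: "'a::metric_space \<Rightarrow> real"
  assumes f: "L-lipschitz_on K f" "\<And>x. x \<in> K \<Longrightarrow> b \<le> f x" and "b > 0"
  shows "(L / b\<^sup>2)-lipschitz_on K (\<lambda>x. inverse (f x))"
proof (rule lipschitz_onI)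
  have L: "L \<ge> 0" using lipschitz_on_nonneg[OF f(1)] .
  fix x y assume xy: "x \<in> K" "y \<in> K"
  have pos: "f x > 0" "f y > 0" using f(2)[OF xy(1)] f(2)[OF xy(2)] assms(3) by auto
  have bb: "b\<^sup>2 \<le> f x * f y"
    unfolding power2_eq_square by (intro mult_mono f(2) xy) (use assms(3) pos in auto)
  have "dist (inverse (f x)) (inverse (f y)) = dist (f x) (f y) / (f x * f y)"
    using pos by (simp add: dist_real_def inverse_diff_inverse abs_mult field_simps abs_minus_commute)
  also have "\<dots> \<le> (L * dist x y) / b\<^sup>2"
    by (intro frac_le bb lipschitz_onD[OF f(1)] xy) (use assms(3) L in auto)
  finally show "dist (inverse (f x)) (inverse (f y)) \<le> L / b\<^sup>2 * dist x y" by simp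
qed (use assms lipschitz_on_nonneg[OF f(1)] in auto)

lemma lipschitz_on_sum:
  fixes f :: "'i \<Rightarrow> 'a::metric_space \<Rightarrow> 'b::real_normed_vector"
  assumes "finite I" and "\<And>i. i \<in> I \<Longrightarrow> \<exists>L. L-lipschitz_on K (f i)"
  shows "\<exists>L. L-lipschitz_on K (\<lambda>x. \<Sum>i\<in>I. f i x)"
  using assms
proof (induction I rule: finite_induct)
  case empty
  show ?case using lipschitz_on_constant by auto
next
  case (insert i I)
  then obtain L M where "L-lipschitz_on K (f i)" "M-lipschitz_on K (\<lambda>x. \<Sum>i\<in>I. f i x)" by force
  then have "(L + M)-lipschitz_on K (\<lambda>x. f i x + (\<Sum>i\<in>I. f i x))" by (rule lipschitz_on_add)
  then show ?case using insert by auto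
qed

text \<open>The field is a finite sum of reciprocals of logarithm arguments times linear commutator
  maps. The bound \<open>b\<close> controls the reciprocals and boundedness of \<open>K\<close> the
  linear factors.\<close>

lemma relative_field_lipschitz:
  assumes \<Gamma>: "\<And>i. \<Gamma> $ i = \<gamma>" "\<gamma> \<noteq> 0" and K: "bounded K" "K \<subseteq> vortex_domain"
    and b: "b > 0" "\<And>\<mu> k. \<mu> \<in> K \<Longrightarrow> k \<in> log_pairs \<Longrightarrow> b \<le> log_arg \<mu> k"
  obtains L where "L-lipschitz_on K (relative_field c \<Gamma>)"
proof -
  define a where "a k = log_weight c \<Gamma> k / \<gamma>" for k
  define ad where "ad k \<mu> = log_gradient k ** \<mu> - \<mu> ** log_gradient k" for k and \<mu> :: "complex^3^3"
  interpret mm: bounded_bilinear "(**) :: complex^3^3 \<Rightarrow> complex^3^3 \<Rightarrow> complex^3^3"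
    by (rule bounded_bilinear_matrix_mult)
  have summand: "\<exists>L. L-lipschitz_on K (\<lambda>\<mu>. inverse (log_arg \<mu> k) *\<^sub>R (a k *\<^sub>R ad k \<mu>))" if k: "k \<in> log_pairs" for k
  proof -
    obtain L1 where "L1-lipschitz_on K (\<lambda>\<mu>. log_linear_part \<mu> k)"
      using bounded_linear.lipschitz_boundE[OF bounded_linear_log_linear_part] by metis
    then have "(0 + L1)-lipschitz_on K (\<lambda>\<mu>. log_arg \<mu> k)"
      unfolding log_arg_def by (intro lipschitz_intros)
    then have l1: "((0 + L1) / b\<^sup>2)-lipschitz_on K (\<lambda>\<mu>. inverse (log_arg \<mu> k))"
      by (rule lipschitz_on_inverse_real) (use b k in auto)
    have bl: "bounded_linear (\<lambda>\<mu>. a k *\<^sub>R ad k \<mu>)"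
      unfolding ad_def
      by (intro bounded_linear_intros mm.bounded_linear_left mm.bounded_linear_right)
    obtain L2 where l2: "L2-lipschitz_on K (\<lambda>\<mu>. a k *\<^sub>R ad k \<mu>)"
      using bounded_linear.lipschitz_boundE[OF bl] by metis
    have "bounded ((\<lambda>\<mu>. a k *\<^sub>R ad k \<mu>) ` K)"
      by (rule bounded_linear_image[OF K(1) bl])
    then obtain B where B: "B > 0" "\<And>\<mu>. \<mu> \<in> K \<Longrightarrow> norm (a k *\<^sub>R ad k \<mu>) \<le> B"
      by (auto simp: bounded_pos)
    have "\<bar>inverse (log_arg \<mu> k)\<bar> \<le> inverse b" if "\<mu> \<in> K" for \<mu>
      using b(1) b(2)[OF that k] by (simp add: le_imp_inverse_le)
    from lipschitz_on_scaleR_bounded[OF l1 this l2 B(2)] b(1) B(1) show ?thesis by auto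
  qed
  obtain L where
    L: "L-lipschitz_on K (\<lambda>\<mu>. \<Sum>k\<in>log_pairs. inverse (log_arg \<mu> k) *\<^sub>R (a k *\<^sub>R ad k \<mu>))"
    using lipschitz_on_sum[of log_pairs K "\<lambda>k \<mu>. inverse (log_arg \<mu> k) *\<^sub>R (a k *\<^sub>R ad k \<mu>)",
        OF finite_log_pairs summand] by blast
  have "relative_field c \<Gamma> \<mu> = (\<Sum>k\<in>log_pairs. inverse (log_arg \<mu> k) *\<^sub>R (a k *\<^sub>R ad k \<mu>))"
    if "\<mu> \<in> K" for \<mu>
  proof -
    have "\<mu> \<in> vortex_domain" using that K(2) by blast
    then show ?thesis
      unfolding relative_field_equal_circulations[OF \<Gamma> \<open>\<mu> \<in> vortex_domain\<close>] ham_gradient_def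
        scaleR_sum_right mm.sum_left mm.sum_right sum_subtractf[symmetric]
      by (intro sum.cong refl) (simp add: mm.scaleR_left mm.scaleR_right ad_def a_def scaleR_diff_right field_simps)
  qed
  then have "L-lipschitz_on K (relative_field c \<Gamma>)"
    by (intro lipschitz_on_transform[OF L]) auto
  then show thesis by (rule that)
qed

section \<open>Conservation of energy, trace and quadratic residual\<close>

lemma solution_conserved:
  fixes f :: "'a::real_normed_vector \<Rightarrow> 'b::real_normed_vector"
  assumes "T \<ge> 0" and x: "solution_on F U {0..T} x"
    and der: "\<And>t. t \<in> {0..T} \<Longrightarrow> x t \<in> U \<Longrightarrow> (x has_vector_derivative F (x t)) (at t within {0..T}) \<Longrightarrow>
      ((\<lambda>s. f (x s)) has_vector_derivative 0) (at t within {0..T})"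
  shows "f (x T) = f (x 0)"
proof -
  have zero: "((\<lambda>s. f (x s)) has_vector_derivative 0) (at t within {0..T})" if "t \<in> {0..T}" for t
    by (rule der) (use x that in \<open>auto simp: solution_on_def\<close>)
  obtain c where "\<And>t. t \<in> {0..T} \<Longrightarrow> f (x t) = c"
    using has_vector_derivative_zero_constant[OF convex_real_interval(5) zero] by blast
  then show ?thesis using assms(1) by simp
qed

text \<open>The rate of change pairs the commutator of \<open>G\<close> and \<mu> with the gradient
  \<open>g\<close>. Moving the commutator across leaves that of \<open>G\<close> and
  \<open>g\<close>, which vanishes because \<open>G\<close> is a multiple of
  \<open>g\<close>.\<close>

lemma vortex_ham_conserved:
  assumes \<Gamma>: "\<And>i. \<Gamma> $ i = \<gamma>" "\<gamma> \<noteq> 0" and "T \<ge> 0"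
    and x: "solution_on (relative_field c \<Gamma>) vortex_domain {0..T} x"
  shows "vortex_ham c \<Gamma> (x T) = vortex_ham c \<Gamma> (x 0)"
proof (rule solution_conserved[OF assms(3) x])
  fix t assume U: "x t \<in> vortex_domain"
    and x: "(x has_vector_derivative relative_field c \<Gamma> (x t)) (at t within {0..T})"
  define g where "g = ham_gradient c \<Gamma> (x t)"
  define G where "G = (1 / \<gamma>) *\<^sub>R g"
  have g: "g \<in> skew_hermitian" unfolding g_def by (rule ham_gradient_skew)
  have G: "G \<in> skew_hermitian" unfolding G_def by (rule subspace_scale[OF subspace_skew_hermitian g])
  have F: "relative_field c \<Gamma> (x t) = G ** x t - x t ** G"
    unfolding G_def g_def by (rule relative_field_equal_circulations[OF \<Gamma> U])
  have xs: "x t \<in> skew_hermitian" using U by (simp add: vortex_domain_def)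
  have "G ** g - g ** G = 0"
    by (simp add: G_def matrix_mult_scaleR_left matrix_mult_scaleR_right)
  then have "skew_inner (relative_field c \<Gamma> (x t)) g = 0"
    unfolding F skew_inner_eq_inner commutator_inner[OF G] by simp
  then show "((\<lambda>s. vortex_ham c \<Gamma> (x s)) has_vector_derivative 0) (at t within {0..T})"
    using vortex_ham_has_derivative_along[OF x U, of c \<Gamma>] commutator_skew_hermitian[OF G xs]
    by (simp add: F g_def has_real_derivative_iff_has_vector_derivative)
qed

lemma bounded_linear_trace: "bounded_linear (trace :: complex^'n^'n \<Rightarrow> complex)"
  unfolding linear_conv_bounded_linear[symmetric]
  by (rule linearI) (simp_all add: trace_def sum.distrib scaleR_sum_right)

lemma trace_conserved:
  assumes \<Gamma>: "\<And>i. \<Gamma> $ i = \<gamma>" "\<gamma> \<noteq> 0" and "T \<ge> 0"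
    and x: "solution_on (relative_field c \<Gamma>) vortex_domain {0..T} x"
  shows "trace (x T) = trace (x 0)"
proof (rule solution_conserved[OF assms(3) x])
  fix t assume U: "x t \<in> vortex_domain"
    and x: "(x has_vector_derivative relative_field c \<Gamma> (x t)) (at t within {0..T})"
  from bounded_linear.has_vector_derivative[OF bounded_linear_trace x]
  have "((\<lambda>s. trace (x s)) has_vector_derivative trace (relative_field c \<Gamma> (x t))) (at t within {0..T})" .
  also have "trace (relative_field c \<Gamma> (x t)) = 0"
    unfolding relative_field_equal_circulations[OF \<Gamma> U] trace_sub by (subst trace_mul_sym) simp
  finally show "((\<lambda>s. trace (x s)) has_vector_derivative 0) (at t within {0..T})" .
qed

text \<open>A constant scalar matrix commutes with \<open>G\<close>, so the residual
  \<open>N\<close> obeys the same commutator equation as the solution, and commutation with a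
  skew-Hermitian matrix preserves the norm.\<close>

lemma quadratic_matrix_norm_conserved:
  assumes \<Gamma>: "\<And>i. \<Gamma> $ i = \<gamma>" "\<gamma> \<noteq> 0" and "T \<ge> 0"
    and x: "solution_on (relative_field c \<Gamma>) vortex_domain {0..T} x"
  shows "norm (x T ** (x T - mat \<tau>)) = norm (x 0 ** (x 0 - mat \<tau>))"
proof -
  interpret mm: bounded_bilinear "(**) :: complex^3^3 \<Rightarrow> complex^3^3 \<Rightarrow> complex^3^3"
    by (rule bounded_bilinear_matrix_mult)
  define N where "N \<mu> = \<mu> ** (\<mu> - mat \<tau>)" for \<mu> :: "complex^3^3"
  have "N (x T) \<bullet> N (x T) = N (x 0) \<bullet> N (x 0)"
  proof (rule solution_conserved[OF assms(3) x, of "\<lambda>\<mu>. N \<mu> \<bullet> N \<mu>"])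
    fix t assume U: "x t \<in> vortex_domain"
      and x: "(x has_vector_derivative relative_field c \<Gamma> (x t)) (at t within {0..T})"
    define G where "G = (1 / \<gamma>) *\<^sub>R ham_gradient c \<Gamma> (x t)"
    have G: "G \<in> skew_hermitian"
      unfolding G_def by (rule subspace_scale[OF subspace_skew_hermitian ham_gradient_skew])
    have F: "relative_field c \<Gamma> (x t) = G ** x t - x t ** G"
      unfolding G_def by (rule relative_field_equal_circulations[OF \<Gamma> U])
    have comm: "mat \<tau> ** G = G ** mat \<tau>"
      by (simp add: mat_def matrix_matrix_mult_def vec_eq_iff if_distrib if_distribR mult.commute cong: if_cong)
    have "((\<lambda>s. N (x s)) has_vector_derivative
        x t ** (G ** x t - x t ** G) + (G ** x t - x t ** G) ** (x t - mat \<tau>)) (at t within {0..T})"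
      unfolding N_def by (rule mm.has_vector_derivative) (use x F in \<open>auto intro!: derivative_eq_intros\<close>)
    also have "x t ** (G ** x t - x t ** G) + (G ** x t - x t ** G) ** (x t - mat \<tau>) = G ** N (x t) - N (x t) ** G"
      unfolding N_def by (simp add: mm.diff_left mm.diff_right matrix_mul_assoc[symmetric] comm)
    finally have dN: "((\<lambda>s. N (x s)) has_vector_derivative (G ** N (x t) - N (x t) ** G)) (at t within {0..T})" .
    have "(G ** N (x t) - N (x t) ** G) \<bullet> N (x t) = 0"
      using commutator_inner[OF G, of "N (x t)" "N (x t)"] by (simp add: inner_commute)
    then show "((\<lambda>s. N (x s) \<bullet> N (x s)) has_vector_derivative 0) (at t within {0..T})"
      using bounded_bilinear.has_vector_derivative[OF bounded_bilinear_inner dN dN] by (simp add: inner_commute)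
  qed
  then show ?thesis by (simp add: N_def norm_eq_sqrt_inner)
qed

section \<open>Rank-one matrices and isolation of the equilateral fixed point\<close>

text \<open>A skew-Hermitian matrix satisfying the quadratic equation has only the eigenvalues 0 and
  its trace, so a nonzero trace has multiplicity one. The positive diagonal entry excludes the
  opposite sign and serves as the pivot of an explicit factorisation.\<close>

lemma rank_one_decomposition:
  assumes skew: "\<mu> \<in> skew_hermitian" and quad: "\<mu> ** (\<mu> - mat (trace \<mu>)) = 0" and pos: "mu_diag \<mu> 1 > 0"
  obtains z :: "3 \<Rightarrow> complex" where "\<And>i j. \<mu> $ i $ j = \<i> * z i * cnj (z j)"
proof -
  define m where "m i j = \<mu> $ i $ j" for i j
  have ent: "m i 1 * m 1 j + m i 2 * m 2 j + m i 3 * m 3 j = (m 1 1 + m 2 2 + m 3 3) * m i j" for i j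
  proof -
    have "(\<mu> ** (\<mu> - mat (trace \<mu>))) $ i $ j = 0" using quad by simp
    then show ?thesis
      using exhaust_3[of j]
      by (auto simp: matrix_matrix_mult_def mat_def trace_def sum_3 m_def algebra_simps)
  qed
  \<comment> \<open>The diagonal equations say that the three principal 2 by 2 minors have pairwise
    sums zero, hence each vanishes.\<close>
  have m22: "m 2 2 * m 1 1 = m 2 1 * m 1 2" using ent[of 1 1] ent[of 2 2] ent[of 3 3] by algebra
  have m33: "m 3 3 * m 1 1 = m 3 1 * m 1 3" using ent[of 1 1] ent[of 2 2] ent[of 3 3] by algebra
  have m23: "m 2 3 * m 1 1 = m 2 1 * m 1 3" using ent[of 2 3] by algebra
  have m32: "m 3 2 * m 1 1 = m 3 1 * m 1 2" using ent[of 3 2] by algebra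
  have minor: "m i j * m 1 1 = m i 1 * m 1 j" for i j
    using exhaust_3[of i] exhaust_3[of j] m22 m33 m23 m32 by (auto simp: mult.commute)
  define d where "d = mu_diag \<mu> 1"
  have d: "d > 0" using pos by (simp add: d_def)
  have m11: "m 1 1 = \<i> * of_real d"
    using skew_hermitian_component[OF skew, of 1 1]
    by (auto simp: m_def d_def mu_diag_def herm_def complex_eq_iff)
  \<comment> \<open>The first column of the Hermitian matrix, normalised by its pivot; this choice
    of phase makes \<open>z 1\<close> positive.\<close>
  define z where "z i = - \<i> * m i 1 / of_real (sqrt d)" for i
  have "\<mu> $ i $ j = \<i> * z i * cnj (z j)" for i j
  proof -
    have sd: "complex_of_real (sqrt d) * complex_of_real (sqrt d) = of_real d"
      using d by (simp flip: of_real_mult)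
    have c: "cnj (m j 1) = - m 1 j"
      using skew_hermitian_component[OF skew, of 1 j] by (simp add: m_def)
    have "\<i> * z i * cnj (z j) = \<i> * m i 1 * cnj (m j 1) / (of_real (sqrt d) * of_real (sqrt d))"
      by (simp add: z_def)
    also have "\<dots> = - \<i> * (m i 1 * m 1 j) / of_real d" by (simp add: sd c)
    also have "\<dots> = m i j" using d by (simp add: minor[symmetric] m11) (simp add: mult_ac)
    finally show ?thesis by (simp add: m_def)
  qed
  then show thesis by (rule that)
qed

definition rank_one_matrix :: "(3 \<Rightarrow> complex) \<Rightarrow> complex^3^3" where
  "rank_one_matrix z = (\<chi> i j. \<i> * z i * cnj (z j))"

lemma rank_one_matrix_simps:
  "mu_diag (rank_one_matrix z) i = (cmod (z i))\<^sup>2"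
  "sqdist (rank_one_matrix z) i j = (cmod (z i - z j))\<^sup>2"
  "trace (rank_one_matrix z) = \<i> * of_real ((cmod (z 1))\<^sup>2 + (cmod (z 2))\<^sup>2 + (cmod (z 3))\<^sup>2)"
  unfolding rank_one_matrix_def mu_diag_def mu_off_def sqdist_def herm_def cmod_power2 trace_def sum_3
  by (simp_all add: complex_eq_iff power2_eq_square algebra_simps)

lemma rank_one_matrix_skew: "rank_one_matrix z \<in> skew_hermitian"
  by (simp add: rank_one_matrix_def skew_hermitian_def ctranspose_def vec_eq_iff mult_ac)

lemma rank_one_matrix_quadratic:
  "rank_one_matrix z ** (rank_one_matrix z - mat (trace (rank_one_matrix z))) = 0"
proof -
  let ?\<mu> = "rank_one_matrix z"
  have "?\<mu> ** ?\<mu> = ?\<mu> ** mat (trace ?\<mu>)"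
    by (simp add: rank_one_matrix_def matrix_matrix_mult_def mat_def trace_def vec_eq_iff if_distrib cong: if_cong)
      (simp add: sum_3 algebra_simps)
  moreover have "?\<mu> ** (?\<mu> - mat (trace ?\<mu>)) = ?\<mu> ** ?\<mu> - ?\<mu> ** mat (trace ?\<mu>)"
    by (rule bounded_bilinear.diff_right[OF bounded_bilinear_matrix_mult])
  ultimately show ?thesis by simp
qed

lemma rank_rank_one_matrix:
  assumes "z 1 \<noteq> 0"
  shows "rank (rank_one_matrix z) = 1"
  unfolding row_rank_def_gen
proof (rule vec.dim_unique[of "{row 1 (rank_one_matrix z)}"])
  let ?v = "row 1 (rank_one_matrix z)"
  show "{?v} \<subseteq> rows (rank_one_matrix z)" by (auto simp: rows_def)
  show "rows (rank_one_matrix z) \<subseteq> vec.span {?v}"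
  proof
    fix x assume "x \<in> rows (rank_one_matrix z)"
    then obtain i where "x = row i (rank_one_matrix z)" by (auto simp: rows_def)
    then have "x = (z i / z 1) *s ?v"
      using assms by (simp add: row_def rank_one_matrix_def vec_eq_iff)
    then show "x \<in> vec.span {?v}" by (simp add: vec.span_scale vec.span_base)
  qed
  have "?v $ 1 \<noteq> 0" using assms by (simp add: row_def rank_one_matrix_def)
  then have "?v \<noteq> 0" by (metis zero_index)
  then show "vec.independent {?v}" by (simp add: vec.dependent_single)
qed simp

lemma vortex_ham_rank_one:
  assumes "\<And>i. \<Gamma> $ i = \<gamma>"
  shows "vortex_ham c \<Gamma> (rank_one_matrix z) = \<gamma>\<^sup>2 / 2 * config_energy c (z 1) (z 2) (z 3)"
  by (simp add: vortex_ham_def config_energy_def index_pairs_def assms rank_one_matrix_simps sum_3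
      power2_eq_square algebra_simps)

text \<open>The squared modulus of the Fourier coefficient of \<open>z\<close> against the weights \<open>a\<close>, as a linear
  function of \<open>\<mu> = rank_one_matrix z\<close>.\<close>

definition fourier_amplitude :: "(3 \<Rightarrow> complex) \<Rightarrow> complex^3^3 \<Rightarrow> real" where
  "fourier_amplitude a \<mu> = Re (\<Sum>i\<in>UNIV. \<Sum>j\<in>UNIV. a i * (- \<i> * \<mu> $ i $ j) * cnj (a j)) / 9"

lemma bounded_linear_fourier_amplitude: "bounded_linear (fourier_amplitude a)"
  unfolding linear_conv_bounded_linear[symmetric]
  by (rule linearI) (simp_all add: fourier_amplitude_def sum_3 algebra_simps diff_divide_distrib add_divide_distrib)

lemma fourier_amplitude_rank_one:
  "fourier_amplitude a (rank_one_matrix z) = (cmod ((a 1 * z 1 + a 2 * z 2 + a 3 * z 3) / 3))\<^sup>2"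
proof -
  have "(\<Sum>i\<in>UNIV. \<Sum>j\<in>UNIV. a i * (- \<i> * rank_one_matrix z $ i $ j) * cnj (a j))
      = (a 1 * z 1 + a 2 * z 2 + a 3 * z 3) * cnj (a 1 * z 1 + a 2 * z 2 + a 3 * z 3)"
    by (simp add: rank_one_matrix_def sum_3 algebra_simps)
  then show ?thesis
    unfolding fourier_amplitude_def by (simp only: complex_norm_square[symmetric]) (simp add: norm_divide power_divide)
qed

section \<open>The equilateral configuration and its isolation\<close>

text \<open>Used in two roles: scaled by \<open>r\<close>, these are the vertices of the triangle;
  as Fourier weights they extract A2, the mode rotating the opposite way.\<close>

definition root_weights :: "3 \<Rightarrow> complex" where
  "root_weights i = (if i = 1 then 1 else if i = 2 then cube_root_unity else cnj cube_root_unity)"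

lemma root_weights_simps:
  "root_weights 1 = 1" "root_weights 2 = cube_root_unity" "root_weights 3 = cnj cube_root_unity"
  by (simp_all add: root_weights_def)

definition equilateral :: "real \<Rightarrow> complex^3^3" where
  "equilateral r = rank_one_matrix (\<lambda>i. of_real r * root_weights i)"

lemma cube_root_unity_relations:
  "cube_root_unity * cnj cube_root_unity = 1" "cube_root_unity * cube_root_unity = cnj cube_root_unity"
  "1 + cube_root_unity + cnj cube_root_unity = 0"
  by (simp_all add: cube_root_unity_eq complex_eq_iff)

lemma equilateral_unique:
  assumes "\<mu> \<in> skew_hermitian"
    and "mu_diag \<mu> 1 = r\<^sup>2" "mu_diag \<mu> 2 = r\<^sup>2" "mu_diag \<mu> 3 = r\<^sup>2"
    and "cnj (mu_off \<mu> 1 2) = of_real (r\<^sup>2) * cube_root_unity"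
    and "cnj (mu_off \<mu> 2 3) = of_real (r\<^sup>2) * cube_root_unity"
    and "mu_off \<mu> 1 3 = of_real (r\<^sup>2) * cube_root_unity"
  shows "\<mu> = equilateral r"
proof -
  let ?\<omega> = cube_root_unity
  note skew = skew_hermitian_component[OF assms(1)]
  have diag: "\<mu> $ i $ i = \<i> * of_real (r\<^sup>2)" for i
    using skew[of i i] assms(2-4) exhaust_3[of i]
    by (auto simp: mu_diag_def herm_def complex_eq_iff)
  have off: "\<mu> $ i $ j = \<i> * mu_off \<mu> i j" for i j by (simp add: mu_off_def herm_def)
  have "mu_off \<mu> 1 2 = cnj (of_real (r\<^sup>2) * ?\<omega>)" "mu_off \<mu> 2 3 = cnj (of_real (r\<^sup>2) * ?\<omega>)"
    using arg_cong[OF assms(5), of cnj] arg_cong[OF assms(6), of cnj] by simp_all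
  then have up: "\<mu> $ 1 $ 2 = \<i> * (of_real (r\<^sup>2) * cnj ?\<omega>)" "\<mu> $ 2 $ 3 = \<i> * (of_real (r\<^sup>2) * cnj ?\<omega>)"
      "\<mu> $ 1 $ 3 = \<i> * (of_real (r\<^sup>2) * ?\<omega>)"
    unfolding off assms(7) by simp_all
  have down: "\<mu> $ 2 $ 1 = \<i> * (of_real (r\<^sup>2) * ?\<omega>)" "\<mu> $ 3 $ 2 = \<i> * (of_real (r\<^sup>2) * ?\<omega>)"
      "\<mu> $ 3 $ 1 = \<i> * (of_real (r\<^sup>2) * cnj ?\<omega>)"
    using skew[of 2 1] skew[of 3 2] skew[of 3 1] up by simp_all
  have sq: "cnj ?\<omega> * cnj ?\<omega> = ?\<omega>" "cnj ?\<omega> * ?\<omega> = 1"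
    by (simp_all add: cube_root_unity_eq complex_eq_iff)
  have "equilateral r $ i $ j = \<i> * of_real (r\<^sup>2) * (root_weights i * cnj (root_weights j))" for i j
    by (simp add: equilateral_def rank_one_matrix_def power2_eq_square mult_ac)
  then show ?thesis
    using diag[of 1] diag[of 2] diag[of 3] up down
    by (simp add: vec_eq_iff forall_3 root_weights_simps cube_root_unity_relations sq)
qed

lemma equilateral_values:
  shows "mu_diag (equilateral r) i = r\<^sup>2"
    and "k \<in> log_pairs \<Longrightarrow> log_arg (equilateral r) k = (if fst k = snd k then 1 - r\<^sup>2 else 3 * r\<^sup>2)"
    and "trace (equilateral r) = \<i> * of_real (3 * r\<^sup>2)"
    and "fourier_amplitude (\<lambda>i. 1) (equilateral r) = 0"
    and "fourier_amplitude root_weights (equilateral r) = 0"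
proof -
  let ?\<omega> = cube_root_unity
  have nrm: "cmod (root_weights i) = 1" for i
    by (simp add: root_weights_def norm_cube_root_unity)
  show diag: "mu_diag (equilateral r) i = r\<^sup>2" for i
    by (simp add: equilateral_def rank_one_matrix_simps norm_mult nrm)
  have dist: "(cmod (1 - ?\<omega>))\<^sup>2 = 3" "(cmod (1 - cnj ?\<omega>))\<^sup>2 = 3" "(cmod (?\<omega> - cnj ?\<omega>))\<^sup>2 = 3"
    by (simp_all add: cmod_power2 cube_root_unity_eq power_divide)
  have "sqdist (equilateral r) i j = r\<^sup>2 * (cmod (root_weights i - root_weights j))\<^sup>2" for i j
    unfolding equilateral_def rank_one_matrix_simps right_diff_distrib[symmetric]
    by (simp add: norm_mult power_mult_distrib)
  then show "k \<in> log_pairs \<Longrightarrow> log_arg (equilateral r) k = (if fst k = snd k then 1 - r\<^sup>2 else 3 * r\<^sup>2)"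
    using diag by (auto simp: log_pairs_def index_pairs_def log_arg_def log_linear_part_def root_weights_simps dist)
  show "trace (equilateral r) = \<i> * of_real (3 * r\<^sup>2)"
    by (simp add: equilateral_def rank_one_matrix_simps norm_mult nrm)
  have "of_real r * root_weights 1 + of_real r * root_weights 2 + of_real r * root_weights 3
      = of_real r * (1 + ?\<omega> + cnj ?\<omega>)"
    by (simp add: root_weights_simps algebra_simps)
  then show "fourier_amplitude (\<lambda>i. 1) (equilateral r) = 0"
    unfolding equilateral_def fourier_amplitude_rank_one by (simp add: cube_root_unity_relations)
  have "root_weights 1 * (of_real r * root_weights 1) + root_weights 2 * (of_real r * root_weights 2)
      + root_weights 3 * (of_real r * root_weights 3) = of_real r * (1 + ?\<omega> + cnj ?\<omega>)"
    by (simp add: root_weights_simps cube_root_unity_eq complex_eq_iff)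
  then show "fourier_amplitude root_weights (equilateral r) = 0"
    unfolding equilateral_def fourier_amplitude_rank_one by (simp add: cube_root_unity_relations)
qed

text \<open>Equal energy contradicts the strict minimum unless A0 and A2 vanish. Then A1 has modulus
  \<open>r\<close>, and its free phase cancels in the matrix.\<close>

lemma equilateral_isolated:
  assumes c: "c > 0" and r: "0 < r" "r < 1" and F2: "F2 c r < 0"
    and \<Gamma>: "\<And>i. \<Gamma> $ i = \<gamma>" "\<gamma> \<noteq> 0"
  obtains q0 where "q0 > 0" and "\<And>\<mu>. \<mu> \<in> skew_hermitian \<Longrightarrow> mu_diag \<mu> 1 > 0 \<Longrightarrow>
    fourier_amplitude (\<lambda>i. 1) \<mu> + fourier_amplitude root_weights \<mu> < q0 \<Longrightarrow>
    trace \<mu> = trace (equilateral r) \<Longrightarrow> \<mu> ** (\<mu> - mat (trace \<mu>)) = 0 \<Longrightarrow>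
    vortex_ham c \<Gamma> \<mu> = vortex_ham c \<Gamma> (equilateral r) \<Longrightarrow> \<mu> = equilateral r"
proof -
  let ?\<omega> = cube_root_unity
  obtain q0 where q0: "q0 > 0"
    and min: "\<And>A0 A1 A2. (cmod A0)\<^sup>2 + (cmod A1)\<^sup>2 + (cmod A2)\<^sup>2 = r\<^sup>2 \<Longrightarrow>
      (cmod A0)\<^sup>2 + (cmod A2)\<^sup>2 < q0 \<Longrightarrow> A0 \<noteq> 0 \<or> A2 \<noteq> 0 \<Longrightarrow>
      config_energy c (A0 + A1 + A2) (A0 + ?\<omega> * A1 + cnj ?\<omega> * A2) (A0 + cnj ?\<omega> * A1 + ?\<omega> * A2)
      > 3 * ln (1 - r\<^sup>2) - 3 * c * ln (3 * r\<^sup>2)"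
    using equilateral_strict_local_minimum[OF c r F2] by blast
  show thesis
  proof (rule that[OF q0])
    fix \<mu> :: "complex^3^3"
    assume \<mu>: "\<mu> \<in> skew_hermitian" "mu_diag \<mu> 1 > 0"
      and q: "fourier_amplitude (\<lambda>i. 1) \<mu> + fourier_amplitude root_weights \<mu> < q0"
      and tr: "trace \<mu> = trace (equilateral r)" and quad: "\<mu> ** (\<mu> - mat (trace \<mu>)) = 0"
      and ham: "vortex_ham c \<Gamma> \<mu> = vortex_ham c \<Gamma> (equilateral r)"
    obtain z where "\<And>i j. \<mu> $ i $ j = \<i> * z i * cnj (z j)"
      using rank_one_decomposition[OF \<mu>(1) quad \<mu>(2)] by blast
    then have z: "\<mu> = rank_one_matrix z" by (simp add: rank_one_matrix_def vec_eq_iff)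
    define A0 where "A0 = (z 1 + z 2 + z 3) / 3"
    define A1 where "A1 = (z 1 + cnj ?\<omega> * z 2 + ?\<omega> * z 3) / 3"
    define A2 where "A2 = (z 1 + ?\<omega> * z 2 + cnj ?\<omega> * z 3) / 3"
    \<comment> \<open>Eliminating the conjugate makes the Fourier inversion polynomial in \<omega>,
      within reach of \<open>algebra\<close>.\<close>
    have cnj_\<omega>: "cnj ?\<omega> = - 1 - ?\<omega>" by (simp add: cube_root_unity_eq complex_eq_iff)
    have \<omega>2: "?\<omega> * ?\<omega> = - 1 - ?\<omega>" using cube_root_unity_relations(2) cnj_\<omega> by simp
    have A: "3 * A0 = z 1 + z 2 + z 3" "3 * A1 = z 1 + (- 1 - ?\<omega>) * z 2 + ?\<omega> * z 3"
        "3 * A2 = z 1 + ?\<omega> * z 2 + (- 1 - ?\<omega>) * z 3"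
      by (simp_all add: A0_def A1_def A2_def cnj_\<omega>)
    have cancel3: "x = y" if "3 * x = 3 * y" for x y :: complex using that by simp
    have "3 * z 1 = 3 * (A0 + A1 + A2)" using A by algebra
    then have z1: "z 1 = A0 + A1 + A2" by (rule cancel3)
    have "3 * z 2 = 3 * (A0 + ?\<omega> * A1 + (- 1 - ?\<omega>) * A2)" using A \<omega>2 by algebra
    then have z2: "z 2 = A0 + ?\<omega> * A1 + cnj ?\<omega> * A2" unfolding cnj_\<omega> by (rule cancel3)
    have "3 * z 3 = 3 * (A0 + (- 1 - ?\<omega>) * A1 + ?\<omega> * A2)" using A \<omega>2 by algebra
    then have z3: "z 3 = A0 + cnj ?\<omega> * A1 + ?\<omega> * A2" unfolding cnj_\<omega> by (rule cancel3)
    have "(cmod (z 1))\<^sup>2 + (cmod (z 2))\<^sup>2 + (cmod (z 3))\<^sup>2 = 3 * r\<^sup>2"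
      using arg_cong[OF tr, of Im] unfolding z rank_one_matrix_simps equilateral_values
      by (simp only: Im_i_times Re_complex_of_real)
    moreover have "(cmod (z 1))\<^sup>2 + (cmod (z 2))\<^sup>2 + (cmod (z 3))\<^sup>2
        = 3 * ((cmod A0)\<^sup>2 + (cmod A1)\<^sup>2 + (cmod A2)\<^sup>2)"
      unfolding z1 z2 z3 fourier_config_modulus(2,3)[of A0 A1 A2] fourier_config_modulus(1)[of A0 A1 A2]
      using cube_root_unity_Re_sums(1)[of "A0 * cnj A1 + cnj A0 * A2 + A1 * cnj A2"] by algebra
    ultimately have S: "(cmod A0)\<^sup>2 + (cmod A1)\<^sup>2 + (cmod A2)\<^sup>2 = r\<^sup>2" by simp
    have q': "(cmod A0)\<^sup>2 + (cmod A2)\<^sup>2 < q0"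
      using q unfolding z fourier_amplitude_rank_one root_weights_simps mult_1_left A0_def A2_def .
    have energy_eq: "config_energy c (z 1) (z 2) (z 3) = 3 * ln (1 - r\<^sup>2) - 3 * c * ln (3 * r\<^sup>2)"
    proof -
      have "vortex_ham c \<Gamma> (equilateral r) = \<gamma>\<^sup>2 / 2 * (3 * ln (1 - r\<^sup>2) - 3 * c * ln (3 * r\<^sup>2))"
        unfolding vortex_ham_eq
        by (simp add: log_pairs_def index_pairs_def equilateral_values log_weight_def \<Gamma>(1) power2_eq_square field_simps)
      then show ?thesis using ham \<Gamma>(2) unfolding z vortex_ham_rank_one[OF \<Gamma>(1)] by simp
    qed
    have A02: "A0 = 0" "A2 = 0"
      using min[OF S q'] energy_eq unfolding z1 z2 z3 by auto
    have "A1 * cnj A1 = of_real (r\<^sup>2)"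
      using S A02 by (simp add: complex_norm_square[symmetric] flip: of_real_power)
    then have "z i * cnj (z j) = of_real r * root_weights i * cnj (of_real r * root_weights j)" for i j
      using z1 z2 z3 A02 exhaust_3[of i] exhaust_3[of j]
      by (auto simp: root_weights_simps power2_eq_square mult_ac)
    then show "\<mu> = equilateral r"
      unfolding z equilateral_def rank_one_matrix_def mult.assoc by (simp add: mult.assoc)
  qed
qed

section \<open>Stability\<close>

lemma continuous_on_vortex_ham: "continuous_on vortex_domain (vortex_ham c \<Gamma>)"
  unfolding vortex_ham_eq log_arg_def
  by (intro continuous_intros linear_continuous_on bounded_linear_log_linear_part)
    (auto simp: vortex_domain_eq log_arg_def)

lemma bounded_linear_mu_diag: "bounded_linear (\<lambda>\<mu>. mu_diag \<mu> i)"
  unfolding linear_conv_bounded_linear[symmetric]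
  by (rule linearI) (simp_all add: mu_diag_def herm_def)

lemma eventually_gt_near:
  fixes f :: "'a::real_normed_vector \<Rightarrow> real"
  assumes "bounded_linear f" and "b < k + f p"
  shows "eventually (\<lambda>x. b < k + f x) (nhds p)"
proof -
  have "isCont (\<lambda>x. k + f x) p"
    by (intro continuous_intros linear_continuous_at assms(1))
  then show ?thesis
    using order_tendstoD(1)[of "\<lambda>x. k + f x" "k + f p" "nhds p" b] assms(2)
    by (simp add: isCont_def tendsto_at_iff_tendsto_nhds[of "\<lambda>x. k + f x" p])
qed

lemma equilateral_neighbourhood:
  assumes "0 < r" "r < 1" "q0 > 0"
  obtains e b where "e > 0" "b > 0" and
    "\<And>\<mu>. \<mu> \<in> cball (equilateral r) e \<Longrightarrow> (\<forall>k\<in>log_pairs. b \<le> log_arg \<mu> k) \<and> mu_diag \<mu> 1 > 0 \<and>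
      fourier_amplitude (\<lambda>i. 1) \<mu> + fourier_amplitude root_weights \<mu> < q0"
proof -
  let ?p = "equilateral r"
  have r2: "0 < r\<^sup>2" "r\<^sup>2 < 1" using assms by (auto simp: power_less_one_iff)
  \<comment> \<open>Half the smallest logarithm argument at the equilibrium, which leaves room for
    continuity.\<close>
  define b where "b = min (1 - r\<^sup>2) (3 * r\<^sup>2) / 2"
  have b: "b > 0" using r2 by (simp add: b_def)
  have "eventually (\<lambda>\<mu>. b < log_arg \<mu> k) (nhds ?p)" if "k \<in> log_pairs" for k
    unfolding log_arg_def
  proof (rule eventually_gt_near[OF bounded_linear_log_linear_part])
    show "b < of_bool (fst k = snd k) + log_linear_part ?p k"
      using equilateral_values(2)[OF that, of r] r2 unfolding log_arg_def b_def by (auto simp: min_def split: if_splits)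
  qed
  then have "eventually (\<lambda>\<mu>. \<forall>k\<in>log_pairs. b < log_arg \<mu> k) (nhds ?p)"
    by (intro eventually_ball_finite finite_log_pairs) auto
  moreover have "eventually (\<lambda>\<mu>. 0 < 0 + mu_diag \<mu> 1) (nhds ?p)"
    by (rule eventually_gt_near[OF bounded_linear_mu_diag]) (use r2 in \<open>simp add: equilateral_values\<close>)
  moreover have "eventually (\<lambda>\<mu>. - q0 < 0 + - (fourier_amplitude (\<lambda>i. 1) \<mu> + fourier_amplitude root_weights \<mu>)) (nhds ?p)"
    by (rule eventually_gt_near, intro bounded_linear_minus bounded_linear_add bounded_linear_fourier_amplitude)
      (use assms in \<open>simp add: equilateral_values\<close>)
  ultimately have "eventually (\<lambda>\<mu>. (\<forall>k\<in>log_pairs. b \<le> log_arg \<mu> k) \<and> mu_diag \<mu> 1 > 0 \<and>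
      fourier_amplitude (\<lambda>i. 1) \<mu> + fourier_amplitude root_weights \<mu> < q0) (nhds ?p)"
    by eventually_elim (auto intro: less_imp_le)
  then obtain d where d: "d > 0" "\<And>\<mu>. dist \<mu> ?p < d \<Longrightarrow> (\<forall>k\<in>log_pairs. b \<le> log_arg \<mu> k) \<and> mu_diag \<mu> 1 > 0 \<and>
      fourier_amplitude (\<lambda>i. 1) \<mu> + fourier_amplitude root_weights \<mu> < q0"
    unfolding eventually_nhds_metric by blast
  show thesis
  proof (rule that[of "d / 2" b])
    show "(\<forall>k\<in>log_pairs. b \<le> log_arg \<mu> k) \<and> mu_diag \<mu> 1 > 0 \<and>
      fourier_amplitude (\<lambda>i. 1) \<mu> + fourier_amplitude root_weights \<mu> < q0" if "\<mu> \<in> cball ?p (d / 2)" for \<mu>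
      by (rule d(2)) (use that d(1) in \<open>simp add: dist_commute\<close>)
  qed (use b d in auto)
qed

lemma equilateral_lyapunov_stable:
  assumes c: "c > 0" and r: "0 < r" "r < 1" and F2: "F2 c r < 0"
    and \<Gamma>: "\<And>i. \<Gamma> $ i = \<gamma>" "\<gamma> \<noteq> 0"
  shows "lyapunov_stable (relative_field c \<Gamma>) vortex_domain rank_one (equilateral r)"
proof -
  let ?p = "equilateral r"
  define \<tau> where "\<tau> = trace ?p"
  \<comment> \<open>All three terms are nonnegative and vanish at the equilibrium, so the single
    equation \<open>V \<mu> = V ?p\<close> yields all three conditions of
    \<open>iso\<close>.\<close>
  define V where "V \<mu> = \<bar>vortex_ham c \<Gamma> \<mu> - vortex_ham c \<Gamma> ?p\<bar> + norm (trace \<mu> - \<tau>)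
      + norm (\<mu> ** (\<mu> - mat \<tau>))" for \<mu>
  \<comment> \<open>A real-linear map with kernel \<open>skew_hermitian\<close>, presenting the
    phase space as an open part of a linear subspace.\<close>
  define P where "P \<xi> = ctranspose \<xi> + \<xi>" for \<xi> :: "complex^3^3"
  have skew_iff: "P \<xi> = 0 \<longleftrightarrow> \<xi> \<in> skew_hermitian" for \<xi>
    by (simp add: P_def skew_hermitian_def eq_neg_iff_add_eq_0)
  obtain q0 where q0: "q0 > 0" and iso: "\<And>\<mu>. \<mu> \<in> skew_hermitian \<Longrightarrow> mu_diag \<mu> 1 > 0 \<Longrightarrow>
    fourier_amplitude (\<lambda>i. 1) \<mu> + fourier_amplitude root_weights \<mu> < q0 \<Longrightarrow>
    trace \<mu> = trace ?p \<Longrightarrow> \<mu> ** (\<mu> - mat (trace \<mu>)) = 0 \<Longrightarrow>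
    vortex_ham c \<Gamma> \<mu> = vortex_ham c \<Gamma> ?p \<Longrightarrow> \<mu> = ?p"
    using equilateral_isolated[OF c r F2 \<Gamma>] by blast
  obtain e b where e: "e > 0" and b: "b > 0" and near: "\<And>\<mu>. \<mu> \<in> cball ?p e \<Longrightarrow>
      (\<forall>k\<in>log_pairs. b \<le> log_arg \<mu> k) \<and> mu_diag \<mu> 1 > 0 \<and>
      fourier_amplitude (\<lambda>i. 1) \<mu> + fourier_amplitude root_weights \<mu> < q0"
    using equilateral_neighbourhood[OF r q0] by blast
  define K where "K = cball ?p e \<inter> {\<mu>. P \<mu> = 0}"
  have KU: "K \<subseteq> vortex_domain"
    using near b unfolding K_def skew_iff vortex_domain_eq by fastforce
  have "bounded K" unfolding K_def by (intro bounded_Int) auto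
  moreover have "b \<le> log_arg \<mu> k" if "\<mu> \<in> K" "k \<in> log_pairs" for \<mu> k
    using near that by (auto simp: K_def)
  ultimately obtain L where L: "L-lipschitz_on K (relative_field c \<Gamma>)"
    using relative_field_lipschitz[OF \<Gamma> _ KU b] by metis
  have p_skew: "?p \<in> skew_hermitian" unfolding equilateral_def by (rule rank_one_matrix_skew)
  have p_quad: "?p ** (?p - mat \<tau>) = 0"
    unfolding \<tau>_def equilateral_def by (rule rank_one_matrix_quadratic)
  show ?thesis
  proof (rule lyapunov_stable_by_conserved_function[where P = P and V = V and ?e0.0 = e and L = L])
    show "bounded_linear P"
      unfolding P_def linear_conv_bounded_linear[symmetric]
      by (intro linear_compose_add linear_ctranspose linear_ident)
    show "P \<mu> = 0" if "\<mu> \<in> vortex_domain" for \<mu>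
      using that by (simp add: skew_iff vortex_domain_def)
    show "?p \<in> vortex_domain"
      using KU e p_skew by (auto simp: K_def skew_iff)
    show "?p \<in> rank_one"
      unfolding rank_one_def using p_skew rank_rank_one_matrix[of "\<lambda>i. of_real r * root_weights i"] r
      by (simp add: equilateral_def root_weights_simps)
    show "cball ?p e \<inter> {m. P m = 0} \<subseteq> vortex_domain" using KU by (simp add: K_def)
    show "L-lipschitz_on (cball ?p e \<inter> {m. P m = 0}) (relative_field c \<Gamma>)" using L by (simp add: K_def)
    show "P (relative_field c \<Gamma> \<mu>) = 0" if "\<mu> \<in> vortex_domain" for \<mu>
      unfolding skew_iff relative_field_equal_circulations[OF \<Gamma> that]
      by (intro commutator_skew_hermitian subspace_scale[OF subspace_skew_hermitian] ham_gradient_skew)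
        (use that in \<open>simp add: vortex_domain_def\<close>)
    show "continuous_on vortex_domain V"
      unfolding V_def
      by (intro continuous_intros continuous_on_vortex_ham linear_continuous_on[OF bounded_linear_trace]
          bounded_bilinear.continuous_on[OF bounded_bilinear_matrix_mult])
    show "V (x T) = V (x 0)" if "T \<ge> 0" "solution_on (relative_field c \<Gamma>) vortex_domain {0..T} x" for T x
      unfolding V_def
      by (simp only: vortex_ham_conserved[OF \<Gamma> that] trace_conserved[OF \<Gamma> that]
          quadratic_matrix_norm_conserved[OF \<Gamma> that])
    fix \<mu> assume \<mu>: "\<mu> \<in> cball ?p e" "P \<mu> = 0" and "V \<mu> = V ?p"
    then have "V \<mu> = 0" by (simp add: V_def \<tau>_def[symmetric] p_quad)
    then have "vortex_ham c \<Gamma> \<mu> = vortex_ham c \<Gamma> ?p \<and> trace \<mu> = \<tau> \<and> \<mu> ** (\<mu> - mat \<tau>) = 0"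
      unfolding V_def by (simp add: add_nonneg_eq_0_iff)
    then show "\<mu> = ?p" using iso[of \<mu>] near[OF \<mu>(1)] \<mu>(2) by (simp add: skew_iff \<tau>_def)
  qed (rule e)
qed

theorem mainTheorem5:
  fixes c r :: real and \<Gamma> :: "real^3" and \<mu>0 :: "complex^3^3"
  assumes "c > 0" and "0 < r" and "r < 1"
    and "\<Gamma> $ 1 = \<Gamma> $ 2" and "\<Gamma> $ 2 = \<Gamma> $ 3" and "\<Gamma> $ 1 \<in> \<int>" and "\<Gamma> $ 1 \<noteq> 0"
    and "\<mu>0 \<in> skew_hermitian"
    and "mu_diag \<mu>0 1 = r\<^sup>2" and "mu_diag \<mu>0 2 = r\<^sup>2" and "mu_diag \<mu>0 3 = r\<^sup>2"
    and "cnj (mu_off \<mu>0 1 2) = complex_of_real (r\<^sup>2) * exp (2 * complex_of_real pi * \<i> / 3)"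
    and "cnj (mu_off \<mu>0 2 3) = complex_of_real (r\<^sup>2) * exp (2 * complex_of_real pi * \<i> / 3)"
    and "mu_off \<mu>0 1 3 = complex_of_real (r\<^sup>2) * exp (2 * complex_of_real pi * \<i> / 3)"
    and "F2 c r < 0"
  shows "lyapunov_stable (relative_field c \<Gamma>) vortex_domain rank_one \<mu>0"
proof -
  have "\<mu>0 = equilateral r"
    by (rule equilateral_unique) (use assms in \<open>simp_all add: cube_root_unity_def\<close>)
  moreover have "\<Gamma> $ i = \<Gamma> $ 1" for i
    using exhaust_3[of i] assms(4,5) by auto
  ultimately show ?thesis
    using equilateral_lyapunov_stable[of c r \<Gamma> "\<Gamma> $ 1"] assms by simp
qed

end
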